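(* Let $M$ be a smooth compact $d$-manifold embedded in $\mathbb{R}^N$ and let $\mathcal{A}=\{(U_i,E_i,D_i)\}_{i\in I}$ be an $(\varepsilon,\eta)$-approximate autoencoder atlas on $M$ with positive non-degeneracy gap $\delta:=\delta(\mathcal{A})>0$. Assume there are constants $L_E,L_E',L_D,L_D'$ such that the following hold uniformly over all charts and on the extended encoder domains $O_i$: (i) $\|d(E_k)_p\|_{\mathrm{op}}\le L_E$ for all $k$ and all $p\in O_k$; (ii) $\|d(E_k)_p-d(E_k)_q\|_{\mathrm{op}}\le L_E'\|p-q\|$ for all $k$ and all $p,q\in O_k$; (iii) $\|d(D_i)_z\|_{\mathrm{op}}\le L_D$ for all $i$ and all $z\in E_i(O_i)$; (iv) $\|d(D_i)_z-d(D_i)_{z'}\|_{\mathrm{op}}\le L_D'\|z-z'\|$ for all $i$ and all $z,z'\in E_i(O_i)$; (v) $\varepsilon<\tau(M)$, where $\tau(M)$ is the reach of $M$. Assume that the enlarged-neighbourhood condition (5) in the definition of approximate autoencoder atlas holds with $R=L_EL_D+3$. Define $$\eta_{\mathrm{eff}}:=\frac{(L_EL_D+2)\,\eta}{1-\eta}+L_\Phi'\,\varepsilon,\qquad L_\Phi':=L_D'L_E^2+L_DL_E',$$ $$\Gamma:=L_E\,\eta_{\mathrm{eff}}\,L_D+L_E'\,\widetilde\varepsilon\,(1+\eta_{\mathrm{eff}})\,L_D,\qquad \widetilde\varepsilon:=(L_EL_D+2)\varepsilon,$$ $$K_{\det}:=d\,C_g\,\varepsilon\,(L_EL_D+C_g\,\varepsilon)^{d-1},\qquad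 C_g:=L_E\,(L_EL_D'+L_E'L_D^2).$$ If $$\eta<1\qquad\text{and}\qquad \max\bigl(d\,\Gamma\,(L_EL_D+\Gamma)^{d-1},\;K_{\det}\bigr)<\delta,$$ then the signs $\omega_{ji}(x):=\operatorname{sign}(\det g_{ji}(x))$ satisfy the Čech cocycle condition: for all $x\in U_i\cap U_j\cap U_k$, $$\omega_{ki}(x)=\omega_{kj}(x)\cdot\omega_{ji}(x).$$ In particular, $\{\omega_{ji}\}$ defines a class $[\omega]\in\check H^1(\mathcal{U};\mathbb{Z}/2)$, where $\mathcal{U}=\{U_i\}_{i\in I}$.
   Context: Manifolds are without boundary. All vector norms are Euclidean; $\|\cdot\|_{\mathrm{op}}$ is the operator norm. The reach $\tau(M)$ is the supremum of $r>0$ such that every point of $\{p\in\mathbb{R}^N:\operatorname{dist}(p,M)<r\}$ has a unique nearest point on $M$. An $(\varepsilon,\eta)$-approximate autoencoder atlas on a smooth $d$-manifold $M\subset\mathbb{R}^N$ is a collection $\{(U_i,E_i,D_i)\}_{i\in I}$ ($I$ finite) where: (1) $\{U_i\}$ is an open cover of $M$; (2) each encoder $E_i$ is a $C^1$ map defined on an open neighbourhood $O_i\supset U_i$ in $\mathbb{R}^N$ with values in $\mathbb{R}^d$, and each decoder $D_i:\tilde Z_i\to\mathbb{R}^N$ is a $C^1$ map on an open set $\tilde Z_i\subset\mathbb{R}^d$ with $\tilde Z_i\supset E_i(O_i)$; (3) $\sup_{x\in U_i}\|D_i(E_i(x))-x\|\le\varepsilon$ for every $i$; (4) $\sup_{x\in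 U_i}\|d(D_i\circ E_i)_x|_{T_xM}-\mathrm{Id}_{T_xM}\|_{\mathrm{op}}\le\eta$ for every $i$, both maps being viewed as maps $T_xM\to\mathbb{R}^N$; (5) there is a constant $R\ge1$ such that the open neighbourhoods $O_i$ contain the closed enlarged neighbourhoods $\{p\in\mathbb{R}^N:\operatorname{dist}(p,U_i)\le R\varepsilon\}$. Transition maps are $T_{ji}=E_j\circ D_i$; for $x\in U_i\cap U_j$, $g_{ji}(x):=d(T_{ji})_{E_i(x)}\in\mathbb{R}^{d\times d}$ (a Jacobian matrix; $D_i(E_i(x))\in O_j$ by (3) and (5)). The non-degeneracy gap is $\delta(\mathcal{A}):=\min_{(i,j):U_i\cap U_j\ne\emptyset}\inf_{x\in U_i\cap U_j}|\det g_{ji}(x)|$. If it is positive, $\omega_{ji}$ is constant on each connected component of $U_i\cap U_j$. $\mathbb{Z}/2$ is identified with $\{\pm1\}$. With respect to a total order on $I$, a Čech $1$-cocycle of $\mathcal{U}$ is a family of locally constant functions $c_{\alpha\beta}:U_\alpha\cap U_\beta\to\{\pm1\}$ ($\alpha<\beta$, nonempty overlap) with $c_{\alpha\gamma}=c_{\alpha\beta}c_{\beta\gamma}$ on nonempty triple intersections, $\alpha<\beta<\gamma$; it is a coboundary if $c_{\alpha\beta}=\nu_\alpha\nu_\beta$ for locally constant $\nu_\alpha:U_\alpha\to\{\pm1\}$; $\check H^1(\mathcal{U};\mathbb{Z}/2)$ is cocycles modulo coboundaries. The family $\{\omega_{ji}\}$ is regarded as the cochain $c_{\alpha\beta}=\omega_{\beta\alpha}$,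 $\alpha<\beta$. *)

theory Defs
  imports "HOL-Analysis.Analysis" "HOL-Algebra.Coset"
begin

section \<open>Differentiability classes and embedded submanifolds\<close>

text \<open>\<open>C\<^sup>k\<close> maps on open sets. Between Euclidean spaces, continuity of all directional derivatives
  of a differentiable map is the same as continuity of its differential.\<close>

primrec Ck_on :: "nat \<Rightarrow> ('a::real_normed_vector \<Rightarrow> 'b::real_normed_vector) \<Rightarrow> 'a set \<Rightarrow> bool" where
  "Ck_on 0 f S \<longleftrightarrow> continuous_on S f"
| "Ck_on (Suc k) f S \<longleftrightarrow>
     (\<forall>x\<in>S. f differentiable (at x)) \<and>
     (\<forall>v. Ck_on k (\<lambda>x. frechet_derivative f (at x) v) S)"

definition smooth_on :: "('a::real_normed_vector \<Rightarrow> 'b::real_normed_vector) \<Rightarrow> 'a set \<Rightarrow> bool" where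
  "smooth_on f S \<longleftrightarrow> (\<forall>k. Ck_on k f S)"

text \<open>Embedded submanifolds without boundary, by slice charts.\<close>

definition smooth_submanifold :: "nat \<Rightarrow> 'a::euclidean_space set \<Rightarrow> bool" where
  "smooth_submanifold d M \<longleftrightarrow>
     (\<forall>p\<in>M. \<exists>W V f g S.
        open W \<and> p \<in> W \<and> open (V :: 'a set) \<and>
        homeomorphism W V f g \<and> smooth_on f W \<and> smooth_on g V \<and>
        subspace S \<and> dim S = d \<and> f ` (W \<inter> M) = V \<inter> S)"

definition tangent_space :: "'a::euclidean_space set \<Rightarrow> 'a \<Rightarrow> 'a set" where
  "tangent_space M x =
     {v. \<exists>(\<gamma> :: real \<Rightarrow> 'a) e. 0 < e \<and> smooth_on \<gamma> {-e<..<e} \<and> \<gamma> ` {-e<..<e} \<subseteq> M \<and>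
           \<gamma> 0 = x \<and> (\<gamma> has_vector_derivative v) (at 0)}"

text \<open>Unlike \<^const>\<open>infdist\<close>, this distance is infinite when the set is empty.\<close>

definition set_edist :: "'a::metric_space \<Rightarrow> 'a set \<Rightarrow> ereal" where
  "set_edist p A = (INF a\<in>A. ereal (dist p a))"

text \<open>The supremum is taken in the extended half-line, whence the inserted \<open>0\<close>.\<close>

definition reach :: "'a::metric_space set \<Rightarrow> ereal" where
  "reach M = Sup (insert 0 {ereal r | r. 0 < r \<and>
     (\<forall>p. set_edist p M < ereal r \<longrightarrow> (\<exists>!q. q \<in> M \<and> (\<forall>q'\<in>M. dist p q \<le> dist p q')))})"

text \<open>Operator norm of the restriction of a linear map to a linear subspace \<open>V\<close>; it is
  \<^const>\<open>onorm\<close> when \<open>V\<close> is the whole space.\<close>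

definition onorm_on :: "'a::real_normed_vector set \<Rightarrow> ('a \<Rightarrow> 'b::real_normed_vector) \<Rightarrow> real" where
  "onorm_on V f = (SUP v\<in>V. norm (f v) / norm v)"


section \<open>Approximate autoencoder atlases\<close>

text \<open>A chart consists of \<open>U\<close>, the encoder \<open>E\<close> on its open domain \<open>O\<close>, and the decoder \<open>D\<close> on its
  open domain \<open>Z\<close>. Encoder and decoder are total functions here; their values outside \<open>O\<close> and \<open>Z\<close>
  are never used.\<close>

record ('n, 'd) ae_chart =
  chart_dom :: "(real ^ 'n) set"
  enc_dom :: "(real ^ 'n) set"
  enc :: "real ^ 'n \<Rightarrow> real ^ 'd"
  dec_dom :: "(real ^ 'd) set"
  dec :: "real ^ 'd \<Rightarrow> real ^ 'n"

definition enlarged_nbhds ::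
  "'i set \<Rightarrow> ('i \<Rightarrow> ('n::finite, 'd::finite) ae_chart) \<Rightarrow> real \<Rightarrow> real \<Rightarrow> bool" where
  "enlarged_nbhds I A \<epsilon> R \<longleftrightarrow>
     (\<forall>i\<in>I. {p. set_edist p (chart_dom (A i)) \<le> ereal (R * \<epsilon>)} \<subseteq> enc_dom (A i))"

definition approx_ae_atlas ::
  "(real ^ 'n::finite) set \<Rightarrow> 'i set \<Rightarrow> ('i \<Rightarrow> ('n, 'd::finite) ae_chart) \<Rightarrow> real \<Rightarrow> real \<Rightarrow> bool" where
  "approx_ae_atlas M I A \<epsilon> \<eta> \<longleftrightarrow>
     finite I \<and>
     (\<forall>i\<in>I. openin (top_of_set M) (chart_dom (A i))) \<and> (\<Union>i\<in>I. chart_dom (A i)) = M \<and>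
     (\<forall>i\<in>I. open (enc_dom (A i)) \<and> chart_dom (A i) \<subseteq> enc_dom (A i) \<and>
            Ck_on 1 (enc (A i)) (enc_dom (A i)) \<and>
            open (dec_dom (A i)) \<and> enc (A i) ` enc_dom (A i) \<subseteq> dec_dom (A i) \<and>
            Ck_on 1 (dec (A i)) (dec_dom (A i))) \<and>
     (\<forall>i\<in>I. \<forall>x\<in>chart_dom (A i). norm (dec (A i) (enc (A i) x) - x) \<le> \<epsilon>) \<and>
     (\<forall>i\<in>I. \<forall>x\<in>chart_dom (A i).
        onorm_on (tangent_space M x)
          (\<lambda>v. frechet_derivative (dec (A i) \<circ> enc (A i)) (at x) v - v) \<le> \<eta>) \<and>
     (\<exists>R\<ge>1. enlarged_nbhds I A \<epsilon> R)"

definition transition ::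
  "('i \<Rightarrow> ('n::finite, 'd::finite) ae_chart) \<Rightarrow> 'i \<Rightarrow> 'i \<Rightarrow> real ^ 'd \<Rightarrow> real ^ 'd" where
  "transition A j i = enc (A j) \<circ> dec (A i)"

definition transition_jac ::
  "('i \<Rightarrow> ('n::finite, 'd::finite) ae_chart) \<Rightarrow> 'i \<Rightarrow> 'i \<Rightarrow> real ^ 'n \<Rightarrow> real ^ 'd ^ 'd" where
  "transition_jac A j i x = jacobian (transition A j i) (at (enc (A i) x))"

text \<open>The outer infimum ranges over a finite set, so it is a minimum; over no pair of charts at all
  (empty \<open>M\<close>) it is \<open>\<infinity>\<close>.\<close>

definition nondegeneracy_gap ::
  "'i set \<Rightarrow> ('i \<Rightarrow> ('n::finite, 'd::finite) ae_chart) \<Rightarrow> ereal" where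
  "nondegeneracy_gap I A =
     (INF (i, j) \<in> {(i, j). i \<in> I \<and> j \<in> I \<and> chart_dom (A i) \<inter> chart_dom (A j) \<noteq> {}}.
        INF x \<in> chart_dom (A i) \<inter> chart_dom (A j). ereal \<bar>det (transition_jac A j i x)\<bar>)"

definition transition_sign ::
  "('i \<Rightarrow> ('n::finite, 'd::finite) ae_chart) \<Rightarrow> 'i \<Rightarrow> 'i \<Rightarrow> real ^ 'n \<Rightarrow> real" where
  "transition_sign A j i x = sgn (det (transition_jac A j i x))"


section \<open>The first Cech cohomology of a cover with coefficients in \<open>{\<plusminus>1}\<close>\<close>

definition locally_constant_on :: "'a::topological_space set \<Rightarrow> ('a \<Rightarrow> 'b) \<Rightarrow> bool" where
  "locally_constant_on S f \<longleftrightarrow>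
     (\<forall>x\<in>S. \<exists>T. openin (top_of_set S) T \<and> x \<in> T \<and> f constant_on T)"

definition cech_pairs :: "'i::linorder set \<Rightarrow> ('i \<Rightarrow> 'a set) \<Rightarrow> ('i \<times> 'i) set" where
  "cech_pairs I U = {(\<alpha>, \<beta>). \<alpha> \<in> I \<and> \<beta> \<in> I \<and> \<alpha> < \<beta> \<and> U \<alpha> \<inter> U \<beta> \<noteq> {}}"

text \<open>Cochains are taken extensional (\<^const>\<open>undefined\<close> off their domain), so that equality
  of cochains is equality of functions on the overlaps.\<close>

definition cech_1_cochains ::
  "'i::linorder set \<Rightarrow> ('i \<Rightarrow> 'a::topological_space set) \<Rightarrow> ('i \<times> 'i \<Rightarrow> 'a \<Rightarrow> real) set" where
  "cech_1_cochains I U =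
     {c \<in> (\<Pi>\<^sub>E (\<alpha>, \<beta>) \<in> cech_pairs I U. U \<alpha> \<inter> U \<beta> \<rightarrow>\<^sub>E {1, -1}).
        \<forall>(\<alpha>, \<beta>) \<in> cech_pairs I U. locally_constant_on (U \<alpha> \<inter> U \<beta>) (c (\<alpha>, \<beta>))}"

definition cech_1_cocycles ::
  "'i::linorder set \<Rightarrow> ('i \<Rightarrow> 'a::topological_space set) \<Rightarrow> ('i \<times> 'i \<Rightarrow> 'a \<Rightarrow> real) set" where
  "cech_1_cocycles I U =
     {c \<in> cech_1_cochains I U.
        \<forall>\<alpha>\<in>I. \<forall>\<beta>\<in>I. \<forall>\<gamma>\<in>I. \<alpha> < \<beta> \<longrightarrow> \<beta> < \<gamma> \<longrightarrow>
          (\<forall>x \<in> U \<alpha> \<inter> U \<beta> \<inter> U \<gamma>. c (\<alpha>, \<gamma>) x = c (\<alpha>, \<beta>) x * c (\<beta>, \<gamma>) x)}"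

definition cech_1_coboundaries ::
  "'i::linorder set \<Rightarrow> ('i \<Rightarrow> 'a::topological_space set) \<Rightarrow> ('i \<times> 'i \<Rightarrow> 'a \<Rightarrow> real) set" where
  "cech_1_coboundaries I U =
     {c \<in> cech_1_cochains I U.
        \<exists>\<nu>. (\<forall>\<alpha>\<in>I. \<nu> \<alpha> ` U \<alpha> \<subseteq> {1, -1} \<and> locally_constant_on (U \<alpha>) (\<nu> \<alpha>)) \<and>
            (\<forall>(\<alpha>, \<beta>) \<in> cech_pairs I U. \<forall>x \<in> U \<alpha> \<inter> U \<beta>. c (\<alpha>, \<beta>) x = \<nu> \<alpha> x * \<nu> \<beta> x)}"

definition cech_Z1 ::
  "'i::linorder set \<Rightarrow> ('i \<Rightarrow> 'a::topological_space set) \<Rightarrow> ('i \<times> 'i \<Rightarrow> 'a \<Rightarrow> real) monoid" where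
  "cech_Z1 I U =
     \<lparr> carrier = cech_1_cocycles I U,
       mult = (\<lambda>c c'. \<lambda>(\<alpha>, \<beta>) \<in> cech_pairs I U. \<lambda>x \<in> U \<alpha> \<inter> U \<beta>. c (\<alpha>, \<beta>) x * c' (\<alpha>, \<beta>) x),
       one = (\<lambda>(\<alpha>, \<beta>) \<in> cech_pairs I U. \<lambda>x \<in> U \<alpha> \<inter> U \<beta>. 1) \<rparr>"

definition cech_H1 ::
  "'i::linorder set \<Rightarrow> ('i \<Rightarrow> 'a::topological_space set) \<Rightarrow> ('i \<times> 'i \<Rightarrow> 'a \<Rightarrow> real) set monoid" where
  "cech_H1 I U = cech_Z1 I U Mod cech_1_coboundaries I U"

definition cech_class ::
  "'i::linorder set \<Rightarrow> ('i \<Rightarrow> 'a::topological_space set) \<Rightarrow> ('i \<times> 'i \<Rightarrow> 'a \<Rightarrow> real)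
     \<Rightarrow> ('i \<times> 'i \<Rightarrow> 'a \<Rightarrow> real) set" where
  "cech_class I U c = cech_1_coboundaries I U #>\<^bsub>cech_Z1 I U\<^esub> c"

definition transition_sign_cochain ::
  "'i::linorder set \<Rightarrow> ('i \<Rightarrow> ('n::finite, 'd::finite) ae_chart) \<Rightarrow> 'i \<times> 'i \<Rightarrow> real ^ 'n \<Rightarrow> real" where
  "transition_sign_cochain I A =
     (\<lambda>(\<alpha>, \<beta>) \<in> cech_pairs I (\<lambda>i. chart_dom (A i)).
        \<lambda>x \<in> chart_dom (A \<alpha>) \<inter> chart_dom (A \<beta>). transition_sign A \<beta> \<alpha> x)"


subsection \<open>The cocycles form an abelian group, with the coboundaries as a subgroup\<close>

lemma locally_constant_on_mult:
  fixes f g :: "'a::topological_space \<Rightarrow> real"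
  assumes "locally_constant_on S f" "locally_constant_on S g"
    and "\<And>x. x \<in> S \<Longrightarrow> h x = f x * g x"
  shows "locally_constant_on S h"
  unfolding locally_constant_on_def
proof
  fix x assume x: "x \<in> S"
  obtain T where T: "openin (top_of_set S) T" "x \<in> T" "f constant_on T"
    using assms(1) x unfolding locally_constant_on_def by blast
  obtain T' where T': "openin (top_of_set S) T'" "x \<in> T'" "g constant_on T'"
    using assms(2) x unfolding locally_constant_on_def by blast
  have "h constant_on (T \<inter> T')"
  proof -
    obtain a where a: "\<And>y. y \<in> T \<Longrightarrow> f y = a" using T(3) unfolding constant_on_def by blast
    obtain b where b: "\<And>y. y \<in> T' \<Longrightarrow> g y = b" using T'(3) unfolding constant_on_def by blast
    have "h y = a * b" if "y \<in> T \<inter> T'" for y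
      using that a b assms(3) openin_imp_subset[OF T(1)] by auto
    then show ?thesis unfolding constant_on_def by blast
  qed
  then show "\<exists>T. openin (top_of_set S) T \<and> x \<in> T \<and> h constant_on T"
    using T T' openin_Int by blast
qed

lemma locally_constant_on_const:
  assumes "\<And>x. x \<in> S \<Longrightarrow> f x = (c :: real)"
  shows "locally_constant_on S f"
  unfolding locally_constant_on_def
proof
  fix x assume "x \<in> S"
  moreover have "openin (top_of_set S) S" by simp
  moreover have "f constant_on S" unfolding constant_on_def using assms by blast
  ultimately show "\<exists>T. openin (top_of_set S) T \<and> x \<in> T \<and> f constant_on T" by blast
qed

context
  fixes I :: "'i::linorder set" and U :: "'i \<Rightarrow> 'a::topological_space set"
begin

lemma cech_1_cochains_iff:
  "c \<in> cech_1_cochains I U \<longleftrightarrow>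
     c \<in> extensional (cech_pairs I U) \<and>
     (\<forall>\<alpha> \<beta>. (\<alpha>, \<beta>) \<in> cech_pairs I U \<longrightarrow>
        c (\<alpha>, \<beta>) \<in> extensional (U \<alpha> \<inter> U \<beta>) \<and>
        (\<forall>x \<in> U \<alpha> \<inter> U \<beta>. c (\<alpha>, \<beta>) x = 1 \<or> c (\<alpha>, \<beta>) x = -1) \<and>
        locally_constant_on (U \<alpha> \<inter> U \<beta>) (c (\<alpha>, \<beta>)))"
  by (simp add: cech_1_cochains_def PiE_iff split_beta split_paired_all Ball_def) blast

lemma cech_1_cochains_eqI:
  assumes "c \<in> cech_1_cochains I U" "c' \<in> cech_1_cochains I U"
    and "\<And>\<alpha> \<beta> x. (\<alpha>, \<beta>) \<in> cech_pairs I U \<Longrightarrow> x \<in> U \<alpha> \<Longrightarrow> x \<in> U \<beta> \<Longrightarrow> c (\<alpha>, \<beta>) x = c' (\<alpha>, \<beta>) x"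
  shows "c = c'"
proof (rule extensionalityI)
  show "c \<in> extensional (cech_pairs I U)" "c' \<in> extensional (cech_pairs I U)"
    using assms(1,2) unfolding cech_1_cochains_iff by blast+
  fix p assume p: "p \<in> cech_pairs I U"
  obtain \<alpha> \<beta> where ab: "p = (\<alpha>, \<beta>)" by (cases p)
  show "c p = c' p"
    unfolding ab
  proof (rule extensionalityI)
    show "c (\<alpha>, \<beta>) \<in> extensional (U \<alpha> \<inter> U \<beta>)" "c' (\<alpha>, \<beta>) \<in> extensional (U \<alpha> \<inter> U \<beta>)"
      using assms(1,2) p unfolding ab cech_1_cochains_iff by blast+
  next
    fix x assume "x \<in> U \<alpha> \<inter> U \<beta>"
    then show "c (\<alpha>, \<beta>) x = c' (\<alpha>, \<beta>) x" using assms(3) p ab by blast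
  qed
qed

lemma cech_mult_apply:
  "(\<alpha>, \<beta>) \<in> cech_pairs I U \<Longrightarrow> x \<in> U \<alpha> \<Longrightarrow> x \<in> U \<beta> \<Longrightarrow>
     (c \<otimes>\<^bsub>cech_Z1 I U\<^esub> c') (\<alpha>, \<beta>) x = c (\<alpha>, \<beta>) x * c' (\<alpha>, \<beta>) x"
  by (simp add: cech_Z1_def)

lemma cech_one_apply:
  "(\<alpha>, \<beta>) \<in> cech_pairs I U \<Longrightarrow> x \<in> U \<alpha> \<Longrightarrow> x \<in> U \<beta> \<Longrightarrow> \<one>\<^bsub>cech_Z1 I U\<^esub> (\<alpha>, \<beta>) x = 1"
  by (simp add: cech_Z1_def)

lemma cech_mult_cochain:
  assumes c: "c \<in> cech_1_cochains I U" and c': "c' \<in> cech_1_cochains I U"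
  shows "c \<otimes>\<^bsub>cech_Z1 I U\<^esub> c' \<in> cech_1_cochains I U"
  unfolding cech_1_cochains_iff
proof (intro conjI allI impI ballI)
  fix \<alpha> \<beta> assume ab: "(\<alpha>, \<beta>) \<in> cech_pairs I U"
  show "locally_constant_on (U \<alpha> \<inter> U \<beta>) ((c \<otimes>\<^bsub>cech_Z1 I U\<^esub> c') (\<alpha>, \<beta>))"
  proof (rule locally_constant_on_mult)
    show "locally_constant_on (U \<alpha> \<inter> U \<beta>) (c (\<alpha>, \<beta>))"
      "locally_constant_on (U \<alpha> \<inter> U \<beta>) (c' (\<alpha>, \<beta>))"
      using c c' ab unfolding cech_1_cochains_iff by blast+
    show "(c \<otimes>\<^bsub>cech_Z1 I U\<^esub> c') (\<alpha>, \<beta>) x = c (\<alpha>, \<beta>) x * c' (\<alpha>, \<beta>) x" if "x \<in> U \<alpha> \<inter> U \<beta>" for x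
      using cech_mult_apply[OF ab] that by blast
  qed
  fix x assume x: "x \<in> U \<alpha> \<inter> U \<beta>"
  have "c (\<alpha>, \<beta>) x = 1 \<or> c (\<alpha>, \<beta>) x = -1" "c' (\<alpha>, \<beta>) x = 1 \<or> c' (\<alpha>, \<beta>) x = -1"
    using c c' ab x unfolding cech_1_cochains_iff by blast+
  then show "(c \<otimes>\<^bsub>cech_Z1 I U\<^esub> c') (\<alpha>, \<beta>) x = 1 \<or> (c \<otimes>\<^bsub>cech_Z1 I U\<^esub> c') (\<alpha>, \<beta>) x = -1"
    using cech_mult_apply[OF ab] x by auto
qed (simp_all add: cech_Z1_def)

lemma cech_one_cochain: "\<one>\<^bsub>cech_Z1 I U\<^esub> \<in> cech_1_cochains I U"
  by (auto simp: cech_1_cochains_iff cech_Z1_def intro: locally_constant_on_const[where c = 1])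

lemma cech_pairsI: "\<alpha> \<in> I \<Longrightarrow> \<beta> \<in> I \<Longrightarrow> \<alpha> < \<beta> \<Longrightarrow> x \<in> U \<alpha> \<Longrightarrow> x \<in> U \<beta> \<Longrightarrow> (\<alpha>, \<beta>) \<in> cech_pairs I U"
  by (auto simp: cech_pairs_def)

lemma cech_Z1_mult_closed:
  assumes "c \<in> cech_1_cocycles I U" "c' \<in> cech_1_cocycles I U"
  shows "c \<otimes>\<^bsub>cech_Z1 I U\<^esub> c' \<in> cech_1_cocycles I U"
proof -
  have "c \<otimes>\<^bsub>cech_Z1 I U\<^esub> c' \<in> cech_1_cochains I U"
    using assms cech_mult_cochain by (simp add: cech_1_cocycles_def)
  moreover have "(c \<otimes>\<^bsub>cech_Z1 I U\<^esub> c') (\<alpha>, \<gamma>) x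
      = (c \<otimes>\<^bsub>cech_Z1 I U\<^esub> c') (\<alpha>, \<beta>) x * (c \<otimes>\<^bsub>cech_Z1 I U\<^esub> c') (\<beta>, \<gamma>) x"
    if h: "\<alpha> \<in> I" "\<beta> \<in> I" "\<gamma> \<in> I" "\<alpha> < \<beta>" "\<beta> < \<gamma>" "x \<in> U \<alpha>" "x \<in> U \<beta>" "x \<in> U \<gamma>" for \<alpha> \<beta> \<gamma> x
  proof -
    have "\<alpha> < \<gamma>" using h by simp
    then have "(\<alpha>, \<beta>) \<in> cech_pairs I U" "(\<beta>, \<gamma>) \<in> cech_pairs I U" "(\<alpha>, \<gamma>) \<in> cech_pairs I U"
      using h by (auto intro: cech_pairsI)
    moreover have "c (\<alpha>, \<gamma>) x = c (\<alpha>, \<beta>) x * c (\<beta>, \<gamma>) x" "c' (\<alpha>, \<gamma>) x = c' (\<alpha>, \<beta>) x * c' (\<beta>, \<gamma>) x"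
      using assms h unfolding cech_1_cocycles_def by blast+
    ultimately show ?thesis using h by (simp add: cech_mult_apply)
  qed
  ultimately show ?thesis unfolding cech_1_cocycles_def by blast
qed

lemma cech_Z1_one_closed: "\<one>\<^bsub>cech_Z1 I U\<^esub> \<in> cech_1_cocycles I U"
proof -
  have "\<one>\<^bsub>cech_Z1 I U\<^esub> (\<alpha>, \<gamma>) x = \<one>\<^bsub>cech_Z1 I U\<^esub> (\<alpha>, \<beta>) x * \<one>\<^bsub>cech_Z1 I U\<^esub> (\<beta>, \<gamma>) x"
    if h: "\<alpha> \<in> I" "\<beta> \<in> I" "\<gamma> \<in> I" "\<alpha> < \<beta>" "\<beta> < \<gamma>" "x \<in> U \<alpha>" "x \<in> U \<beta>" "x \<in> U \<gamma>" for \<alpha> \<beta> \<gamma> x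
  proof -
    have "\<alpha> < \<gamma>" using h by simp
    then have "(\<alpha>, \<beta>) \<in> cech_pairs I U" "(\<beta>, \<gamma>) \<in> cech_pairs I U" "(\<alpha>, \<gamma>) \<in> cech_pairs I U"
      using h by (auto intro: cech_pairsI)
    then show ?thesis using h by (simp add: cech_one_apply)
  qed
  then show ?thesis using cech_one_cochain unfolding cech_1_cocycles_def by blast
qed

lemma cech_mult_self:
  assumes "c \<in> cech_1_cochains I U"
  shows "c \<otimes>\<^bsub>cech_Z1 I U\<^esub> c = \<one>\<^bsub>cech_Z1 I U\<^esub>"
proof (rule cech_1_cochains_eqI)
  fix \<alpha> \<beta> x assume h: "(\<alpha>, \<beta>) \<in> cech_pairs I U" "x \<in> U \<alpha>" "x \<in> U \<beta>"
  have "c (\<alpha>, \<beta>) x = 1 \<or> c (\<alpha>, \<beta>) x = -1"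
    using assms h unfolding cech_1_cochains_iff by blast
  then show "(c \<otimes>\<^bsub>cech_Z1 I U\<^esub> c) (\<alpha>, \<beta>) x = \<one>\<^bsub>cech_Z1 I U\<^esub> (\<alpha>, \<beta>) x"
    using h by (auto simp: cech_mult_apply cech_one_apply)
qed (simp_all add: assms cech_mult_cochain cech_one_cochain)

lemma cech_cocycle_cochain: "c \<in> carrier (cech_Z1 I U) \<Longrightarrow> c \<in> cech_1_cochains I U"
  by (simp add: cech_Z1_def cech_1_cocycles_def)

lemma carrier_cech_Z1: "carrier (cech_Z1 I U) = cech_1_cocycles I U"
  by (simp add: cech_Z1_def)

lemma comm_group_cech_Z1: "comm_group (cech_Z1 I U)"
proof (rule comm_groupI)
  fix c assume c: "c \<in> carrier (cech_Z1 I U)"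
  then show "\<exists>y\<in>carrier (cech_Z1 I U). y \<otimes>\<^bsub>cech_Z1 I U\<^esub> c = \<one>\<^bsub>cech_Z1 I U\<^esub>"
    using cech_mult_self cech_cocycle_cochain by blast
  show "\<one>\<^bsub>cech_Z1 I U\<^esub> \<otimes>\<^bsub>cech_Z1 I U\<^esub> c = c"
    by (rule cech_1_cochains_eqI)
      (simp_all add: c cech_cocycle_cochain cech_mult_cochain cech_one_cochain
        cech_mult_apply cech_one_apply)
next
  fix a b c
  assume h: "a \<in> carrier (cech_Z1 I U)" "b \<in> carrier (cech_Z1 I U)" "c \<in> carrier (cech_Z1 I U)"
  show "a \<otimes>\<^bsub>cech_Z1 I U\<^esub> b \<otimes>\<^bsub>cech_Z1 I U\<^esub> c = a \<otimes>\<^bsub>cech_Z1 I U\<^esub> (b \<otimes>\<^bsub>cech_Z1 I U\<^esub> c)"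
    by (rule cech_1_cochains_eqI)
      (simp_all add: h cech_cocycle_cochain cech_mult_cochain cech_mult_apply)
next
  fix a b
  assume h: "a \<in> carrier (cech_Z1 I U)" "b \<in> carrier (cech_Z1 I U)"
  show "a \<otimes>\<^bsub>cech_Z1 I U\<^esub> b \<in> carrier (cech_Z1 I U)"
    using h cech_Z1_mult_closed by (simp add: carrier_cech_Z1)
  show "a \<otimes>\<^bsub>cech_Z1 I U\<^esub> b = b \<otimes>\<^bsub>cech_Z1 I U\<^esub> a"
    by (rule cech_1_cochains_eqI)
      (simp_all add: h cech_cocycle_cochain cech_mult_cochain cech_mult_apply)
qed (simp add: carrier_cech_Z1 cech_Z1_one_closed)

lemma cech_1_coboundaries_subset: "cech_1_coboundaries I U \<subseteq> cech_1_cocycles I U"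
proof
  fix c assume "c \<in> cech_1_coboundaries I U"
  then have c: "c \<in> cech_1_cochains I U"
    and "\<exists>\<nu>. (\<forall>\<alpha>\<in>I. \<nu> \<alpha> ` U \<alpha> \<subseteq> {1, -1} \<and> locally_constant_on (U \<alpha>) (\<nu> \<alpha>)) \<and>
          (\<forall>(\<alpha>, \<beta>) \<in> cech_pairs I U. \<forall>x \<in> U \<alpha> \<inter> U \<beta>. c (\<alpha>, \<beta>) x = \<nu> \<alpha> x * \<nu> \<beta> x)"
    by (simp_all add: cech_1_coboundaries_def)
  then obtain \<nu> where \<nu>: "\<forall>\<alpha>\<in>I. \<nu> \<alpha> ` U \<alpha> \<subseteq> {1, -1} \<and> locally_constant_on (U \<alpha>) (\<nu> \<alpha>)"
    and eq: "\<forall>(\<alpha>, \<beta>) \<in> cech_pairs I U. \<forall>x \<in> U \<alpha> \<inter> U \<beta>. c (\<alpha>, \<beta>) x = \<nu> \<alpha> x * \<nu> \<beta> x"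
    by (elim exE conjE)
  have "c (\<alpha>, \<gamma>) x = c (\<alpha>, \<beta>) x * c (\<beta>, \<gamma>) x"
    if h: "\<alpha> \<in> I" "\<beta> \<in> I" "\<gamma> \<in> I" "\<alpha> < \<beta>" "\<beta> < \<gamma>" "x \<in> U \<alpha>" "x \<in> U \<beta>" "x \<in> U \<gamma>" for \<alpha> \<beta> \<gamma> x
  proof -
    have "\<alpha> < \<gamma>" using h by simp
    then have "(\<alpha>, \<beta>) \<in> cech_pairs I U" "(\<beta>, \<gamma>) \<in> cech_pairs I U" "(\<alpha>, \<gamma>) \<in> cech_pairs I U"
      using h by (auto intro: cech_pairsI)
    then have "c (\<alpha>, \<beta>) x = \<nu> \<alpha> x * \<nu> \<beta> x" "c (\<beta>, \<gamma>) x = \<nu> \<beta> x * \<nu> \<gamma> x"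
      "c (\<alpha>, \<gamma>) x = \<nu> \<alpha> x * \<nu> \<gamma> x"
      using eq h by fast+
    moreover have "\<nu> \<beta> x = 1 \<or> \<nu> \<beta> x = -1" using \<nu> h by blast
    ultimately show ?thesis by auto
  qed
  then show "c \<in> cech_1_cocycles I U" using c unfolding cech_1_cocycles_def by blast
qed

lemma subgroup_cech_1_coboundaries: "subgroup (cech_1_coboundaries I U) (cech_Z1 I U)"
proof -
  interpret comm_group "cech_Z1 I U" by (rule comm_group_cech_Z1)
  show ?thesis
  proof (rule subgroupI)
    show "cech_1_coboundaries I U \<subseteq> carrier (cech_Z1 I U)"
      using cech_1_coboundaries_subset by (simp add: carrier_cech_Z1)
    have "\<one>\<^bsub>cech_Z1 I U\<^esub> \<in> cech_1_coboundaries I U"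
      unfolding cech_1_coboundaries_def
      using cech_one_cochain
      by (intro CollectI conjI exI[of _ "\<lambda>_ _. 1"])
        (auto simp: cech_one_apply intro: locally_constant_on_const)
    then show "cech_1_coboundaries I U \<noteq> {}" by blast
  next
    fix c assume c: "c \<in> cech_1_coboundaries I U"
    then have "c \<in> carrier (cech_Z1 I U)"
      using cech_1_coboundaries_subset by (auto simp: carrier_cech_Z1)
    then have "inv\<^bsub>cech_Z1 I U\<^esub> c = c"
      using cech_mult_self cech_cocycle_cochain inv_equality by blast
    then show "inv\<^bsub>cech_Z1 I U\<^esub> c \<in> cech_1_coboundaries I U" using c by simp
  next
    fix c c' assume c: "c \<in> cech_1_coboundaries I U" and c': "c' \<in> cech_1_coboundaries I U"
    obtain \<nu> where \<nu>: "\<forall>\<alpha>\<in>I. \<nu> \<alpha> ` U \<alpha> \<subseteq> {1, -1} \<and> locally_constant_on (U \<alpha>) (\<nu> \<alpha>)"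
      "\<forall>(\<alpha>, \<beta>) \<in> cech_pairs I U. \<forall>x \<in> U \<alpha> \<inter> U \<beta>. c (\<alpha>, \<beta>) x = \<nu> \<alpha> x * \<nu> \<beta> x"
      using c unfolding cech_1_coboundaries_def by (elim CollectE exE conjE)
    obtain \<mu> where \<mu>: "\<forall>\<alpha>\<in>I. \<mu> \<alpha> ` U \<alpha> \<subseteq> {1, -1} \<and> locally_constant_on (U \<alpha>) (\<mu> \<alpha>)"
      "\<forall>(\<alpha>, \<beta>) \<in> cech_pairs I U. \<forall>x \<in> U \<alpha> \<inter> U \<beta>. c' (\<alpha>, \<beta>) x = \<mu> \<alpha> x * \<mu> \<beta> x"
      using c' unfolding cech_1_coboundaries_def by (elim CollectE exE conjE)
    have "\<forall>\<alpha>\<in>I. (\<lambda>x. \<nu> \<alpha> x * \<mu> \<alpha> x) ` U \<alpha> \<subseteq> {1, -1} \<and> locally_constant_on (U \<alpha>) (\<lambda>x. \<nu> \<alpha> x * \<mu> \<alpha> x)"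
    proof (intro ballI conjI)
      fix \<alpha> assume a: "\<alpha> \<in> I"
      show "locally_constant_on (U \<alpha>) (\<lambda>x. \<nu> \<alpha> x * \<mu> \<alpha> x)"
        by (rule locally_constant_on_mult[of _ "\<nu> \<alpha>" "\<mu> \<alpha>"]) (use \<nu>(1) \<mu>(1) a in simp_all)
      have "\<nu> \<alpha> x * \<mu> \<alpha> x \<in> {1, -1}" if "x \<in> U \<alpha>" for x
      proof -
        have "\<nu> \<alpha> x = 1 \<or> \<nu> \<alpha> x = -1" "\<mu> \<alpha> x = 1 \<or> \<mu> \<alpha> x = -1"
          using \<nu>(1) \<mu>(1) a that by blast+
        then show ?thesis by auto
      qed
      then show "(\<lambda>x. \<nu> \<alpha> x * \<mu> \<alpha> x) ` U \<alpha> \<subseteq> {1, -1}" by blast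
    qed
    moreover have "\<forall>(\<alpha>, \<beta>) \<in> cech_pairs I U. \<forall>x \<in> U \<alpha> \<inter> U \<beta>.
        (c \<otimes>\<^bsub>cech_Z1 I U\<^esub> c') (\<alpha>, \<beta>) x = (\<nu> \<alpha> x * \<mu> \<alpha> x) * (\<nu> \<beta> x * \<mu> \<beta> x)"
    proof (clarify)
      fix \<alpha> \<beta> x assume h: "(\<alpha>, \<beta>) \<in> cech_pairs I U" "x \<in> U \<alpha>" "x \<in> U \<beta>"
      have "c (\<alpha>, \<beta>) x = \<nu> \<alpha> x * \<nu> \<beta> x" "c' (\<alpha>, \<beta>) x = \<mu> \<alpha> x * \<mu> \<beta> x"
        using h \<nu>(2) \<mu>(2) by fast+
      then show "(c \<otimes>\<^bsub>cech_Z1 I U\<^esub> c') (\<alpha>, \<beta>) x = (\<nu> \<alpha> x * \<mu> \<alpha> x) * (\<nu> \<beta> x * \<mu> \<beta> x)"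
        using h by (simp add: cech_mult_apply)
    qed
    moreover have "c \<otimes>\<^bsub>cech_Z1 I U\<^esub> c' \<in> cech_1_cochains I U"
      using c c' cech_mult_cochain by (auto simp: cech_1_coboundaries_def)
    ultimately show "c \<otimes>\<^bsub>cech_Z1 I U\<^esub> c' \<in> cech_1_coboundaries I U"
      unfolding cech_1_coboundaries_def
      by (intro CollectI conjI exI[of _ "\<lambda>\<alpha> x. \<nu> \<alpha> x * \<mu> \<alpha> x"])
  qed
qed

lemma comm_group_cech_H1: "comm_group (cech_H1 I U)"
  unfolding cech_H1_def
  by (rule comm_group.abelian_FactGroup[OF comm_group_cech_Z1 subgroup_cech_1_coboundaries])

end

end

theory Submission
  imports Defs
begin

text \<open>Let \<open>p = D\<^sub>i (E\<^sub>i x)\<close>, a point within \<open>\<epsilon>\<close> of \<open>x\<close>. By the chain rule \<open>g\<^sub>k\<^sub>j(p) g\<^sub>j\<^sub>i(x)\<close> is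
  \<open>g\<^sub>k\<^sub>i(x)\<close> with the reconstruction \<open>D\<^sub>j \<circ> E\<^sub>j\<close> inserted at \<open>p\<close>. Since \<open>\<eta> < 1\<close>, every vector in the
  range of \<open>dD\<^sub>i\<close> at \<open>E\<^sub>i x\<close> is the image under \<open>d(D\<^sub>i \<circ> E\<^sub>i)\<close> of a tangent vector and hence close to
  it, so the differential of that reconstruction moves it little. As \<open>g\<^sub>k\<^sub>j(p)\<close> is close to
  \<open>g\<^sub>k\<^sub>j(x)\<close> by the Lipschitz bounds, \<open>g\<^sub>k\<^sub>j(p) g\<^sub>j\<^sub>i(x)\<close> and \<open>g\<^sub>k\<^sub>j(p)\<close> differ from \<open>g\<^sub>k\<^sub>i(x)\<close> and \<open>g\<^sub>k\<^sub>j(x)\<close>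
  by at most \<open>\<Gamma>\<close> and \<open>C\<^sub>g \<epsilon>\<close> in operator norm. Hadamard's inequality turns this into determinant
  differences below the gap \<open>\<delta>\<close>, which cannot change signs.\<close>

section \<open>Hadamard's inequality and perturbation of determinants\<close>

text \<open>Gram-Schmidt without normalisation: subtracting from a row its projection onto the span
  of the rows treated so far keeps the determinant and, by Pythagoras, does not lengthen the row.
  The induction runs over the set \<open>S\<close> of rows already made orthogonal.\<close>

lemma ex_orthogonal_rows_same_det:
  fixes A :: "real ^ 'n ^ 'n"
  shows "\<exists>B :: real ^ 'n ^ 'n. det B = det A \<and> (\<forall>i. norm (B $ i) \<le> norm (A $ i)) \<and>
           pairwise (\<lambda>i j. orthogonal (B $ i) (B $ j)) S"
proof (induction S rule: infinite_finite_induct)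
  case (insert k S)
  then obtain B :: "real ^ 'n ^ 'n" where B: "det B = det A" "\<And>i. norm (B $ i) \<le> norm (A $ i)"
      "pairwise (\<lambda>i j. orthogonal (B $ i) (B $ j)) S"
    by blast
  obtain y z where y: "y \<in> span (($) B ` S)"
    and z: "\<And>w. w \<in> span (($) B ` S) \<Longrightarrow> orthogonal z w" and yz: "B $ k = y + z"
    using orthogonal_subspace_decomp_exists[of "($) B ` S"  "B $ k"] by metis
  define C :: "real ^ 'n ^ 'n" where "C = (\<chi> i. if i = k then row k B + (- y) else row i B)"
  have Ck: "C $ k = z" and Ci: "i \<noteq> k \<Longrightarrow> C $ i = B $ i" for i
    by (simp_all add: C_def row_def yz vec_eq_iff)
  have "span (($) B ` S) \<subseteq> span {row j B | j. j \<noteq> k}"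
    using insert.hyps by (intro span_mono) (auto simp: row_def vec_lambda_eta)
  \<comment> \<open>\<open>det_row_span\<close> speaks of the span for the scalar multiplication of
    vectors over a field, hence \<open>vec.span\<close>. Row \<open>k\<close> of \<open>C\<close> is
    written as \<open>row k B + (- y)\<close> to fit the same rule.\<close>
  then have "- y \<in> vec.span {row j B | j. j \<noteq> k}"
    using y span_neg by (auto simp: span_vec_eq)
  then have "det C = det B"
    unfolding C_def by (rule det_row_span)
  moreover have "norm z \<le> norm (B $ k)"
  proof -
    have "orthogonal y z" using z[OF y] by (simp add: orthogonal_commute)
    then have "norm (B $ k) ^ 2 = norm y ^ 2 + norm z ^ 2"
      unfolding yz by (rule norm_add_Pythagorean)
    then show ?thesis by (simp add: abs_le_square_iff[symmetric] power2_le_imp_le)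
  qed
  then have "norm (C $ i) \<le> norm (A $ i)" for i
    using B(2)[of i] B(2)[of k] Ck Ci[of i] by (cases "i = k") auto
  moreover have "pairwise (\<lambda>i j. orthogonal (C $ i) (C $ j)) (insert k S)"
  proof -
    have "orthogonal z (B $ j)" if "j \<in> S" for j
      using that by (intro z span_base) auto
    then have "orthogonal (C $ k) (C $ j) \<and> orthogonal (C $ j) (C $ k)" if "j \<in> S" "j \<noteq> k" for j
      using that by (simp add: Ck Ci orthogonal_commute)
    moreover have "pairwise (\<lambda>i j. orthogonal (C $ i) (C $ j)) S"
      using B(3) insert.hyps unfolding pairwise_def by (metis Ci)
    ultimately show ?thesis by (auto simp: pairwise_insert)
  qed
  ultimately show ?case using B(1) by metis
qed auto

text \<open>For orthogonal rows \<open>B ** transpose B\<close> is diagonal with the squared row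
  norms as entries, so the bound is an equality for \<open>B\<close>; passing back to
  \<open>A\<close> only lengthens rows.\<close>

lemma Hadamard_inequality:
  fixes A :: "real ^ 'n ^ 'n"
  shows "\<bar>det A\<bar> \<le> (\<Prod>i\<in>UNIV. norm (A $ i))"
proof -
  obtain B :: "real ^ 'n ^ 'n" where B: "det B = det A" "\<And>i. norm (B $ i) \<le> norm (A $ i)"
      "pairwise (\<lambda>i j. orthogonal (B $ i) (B $ j)) UNIV"
    using ex_orthogonal_rows_same_det by metis
  have BB: "(B ** transpose B) $ i $ j = B $ i \<bullet> B $ j" for i j
    by (simp add: matrix_matrix_mult_def transpose_def inner_vec_def)
  have "det (B ** transpose B) = (\<Prod>i\<in>UNIV. (B ** transpose B) $ i $ i)"
    using B(3) by (intro det_diagonal) (simp add: BB pairwise_def orthogonal_def)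
  also have "\<dots> = (\<Prod>i\<in>UNIV. norm (B $ i)) ^ 2"
    by (simp add: BB power2_norm_eq_inner prod_power_distrib)
  finally have "(det B) ^ 2 = (\<Prod>i\<in>UNIV. norm (B $ i)) ^ 2"
    by (simp add: det_mul power2_eq_square)
  then have "\<bar>det A\<bar> = (\<Prod>i\<in>UNIV. norm (B $ i))"
    using B(1) by (simp add: power2_eq_iff prod_nonneg abs_if) (smt (verit) prod_nonneg norm_ge_zero)
  also have "\<dots> \<le> (\<Prod>i\<in>UNIV. norm (A $ i))"
    using B(2) by (intro prod_mono) simp
  finally show ?thesis .
qed

text \<open>Rows of \<open>B\<close> are exchanged for rows of \<open>A\<close> one at a time. By
  additivity in row \<open>k\<close>, one exchange changes the determinant by that of a matrix with
  \<open>A $ k - B $ k\<close> in row \<open>k\<close>, which Hadamard bounds by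
  \<open>h * m ^ (CARD('n) - 1)\<close>.\<close>

lemma det_diff_le_rows:
  fixes A B :: "real ^ 'n::finite ^ 'n"
  assumes A: "\<And>i. norm (A $ i) \<le> m" and B: "\<And>i. norm (B $ i) \<le> m"
    and h: "\<And>i. norm (A $ i - B $ i) \<le> h"
  shows "\<bar>det A - det B\<bar> \<le> real CARD('n) * h * m ^ (CARD('n) - 1)"
proof -
  have "\<bar>det (\<chi> i. if i \<in> S then A $ i else B $ i) - det B\<bar>
      \<le> real (card S) * h * m ^ (CARD('n) - 1)" for S :: "'n set"
  proof (induction S rule: infinite_finite_induct)
    case (insert k S)
    \<comment> \<open>The rows other than \<open>k\<close> agree before and after the exchange;
      \<open>?row\<close> leaves only row \<open>k\<close> free.\<close>
    define C where "C i = (if i \<in> S then A $ i else B $ i)" for i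
    let ?row = "\<lambda>v. (\<chi> i. if i = k then v else C i) :: real ^ 'n ^ 'n"
    have "(\<chi> i. if i \<in> insert k S then A $ i else B $ i) = ?row (A $ k)"
      "(\<chi> i. if i \<in> S then A $ i else B $ i) = ?row (B $ k)"
      using insert.hyps by (auto simp: vec_eq_iff C_def)
    moreover have "det (?row (A $ k)) = det (?row (A $ k - B $ k)) + det (?row (B $ k))"
      using det_row_add[of k "\<lambda>_. A $ k - B $ k" "\<lambda>_. B $ k" C]
      by (simp only: diff_add_cancel)
    moreover have "\<bar>det (?row (A $ k - B $ k))\<bar> \<le> h * m ^ (CARD('n) - 1)"
    proof -
      have "\<bar>det (?row (A $ k - B $ k))\<bar> \<le> (\<Prod>i\<in>UNIV. norm (?row (A $ k - B $ k) $ i))"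
        by (rule Hadamard_inequality)
      also have "\<dots> = norm (A $ k - B $ k) * (\<Prod>i\<in>UNIV - {k}. norm (C i))"
        by (subst prod.remove[of _ k]) auto
      also have "\<dots> \<le> h * (\<Prod>i\<in>UNIV - {k}. m)"
        using A B h[of k] order_trans[OF norm_ge_zero h[of k]]
        by (intro mult_mono prod_mono prod_nonneg) (auto simp: C_def)
      finally show ?thesis by simp
    qed
    ultimately show ?case
      using insert by (simp add: algebra_simps)
  qed auto
  from this[of UNIV] show ?thesis by simp
qed

text \<open>Columns are images of unit vectors, so operator bounds become column bounds, and
  transposition turns these into row bounds. The columns of both matrices are bounded by
  \<open>m + h\<close>.\<close>

lemma det_diff_le:
  fixes A B :: "real ^ 'n::finite ^ 'n"
  assumes B: "\<And>v. norm (B *v v) \<le> m * norm v"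
    and h: "\<And>v. norm (A *v v - B *v v) \<le> h * norm v"
  shows "\<bar>det A - det B\<bar> \<le> real CARD('n) * h * (m + h) ^ (CARD('n) - 1)"
proof -
  have col: "transpose X $ i = X *v axis i 1" for X :: "real ^ 'n ^ 'n" and i
    by (simp add: matrix_vector_mult_basis column_def transpose_def)
  have "norm (A *v axis i 1 - B *v axis i 1) \<le> h" "norm (B *v axis i 1) \<le> m" for i
    using B[of "axis i 1"] h[of "axis i 1"] by simp_all
  moreover from this have "norm (A *v axis i 1) \<le> m + h" for i
    by (meson add_mono norm_triangle_sub order_trans)
  moreover have "0 \<le> h"
    using calculation(1) norm_ge_zero order_trans by blast
  ultimately have "\<bar>det (transpose A) - det (transpose B)\<bar>
      \<le> real CARD('n) * h * (m + h) ^ (CARD('n) - 1)"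
    by (intro det_diff_le_rows) (auto simp: col add_increasing2)
  then show ?thesis by simp
qed

section \<open>Tangent spaces of embedded submanifolds\<close>

text \<open>On an open set, maps that agree also have the same derivatives there, and so the
  induction passes to the directional derivatives.\<close>

lemma Ck_on_cong_open:
  assumes "open S" "\<And>x. x \<in> S \<Longrightarrow> f x = g x" "Ck_on k f S"
  shows "Ck_on k g S"
  using assms(2,3)
proof (induction k arbitrary: f g)
  case 0
  then show ?case using continuous_on_eq by (metis Ck_on.simps(1))
next
  case (Suc k)
  have f: "f differentiable (at x)" if "x \<in> S" for x
    using Suc.prems(2) that by simp
  have eq: "frechet_derivative f (at x) = frechet_derivative g (at x)" if "x \<in> S" for x
    using frechet_derivative_transform_within_open[OF f[OF that] assms(1) that] Suc.prems(1) by blast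
  have "g differentiable (at x)" if "x \<in> S" for x
  proof -
    have "(f has_derivative frechet_derivative f (at x)) (at x)"
      using f[OF that] by (simp add: frechet_derivative_works)
    then have "(g has_derivative frechet_derivative f (at x)) (at x)"
      using has_derivative_transform_within_open[OF _ assms(1) that] Suc.prems(1) by blast
    then show ?thesis by (auto simp: differentiable_def)
  qed
  moreover have "Ck_on k (\<lambda>x. frechet_derivative g (at x) v) S" for v
    by (rule Suc.IH[of "\<lambda>x. frechet_derivative f (at x) v"]) (use Suc.prems(2) eq in auto)
  ultimately show ?case by simp
qed

text \<open>Provides the smoothness of the curves that represent tangent vectors. The derivative
  along the line is a directional derivative of \<open>g\<close> restricted to the same line, so the
  induction must keep \<open>g\<close> arbitrary.\<close>

lemma Ck_on_compose_line:
  assumes "open T" "\<And>t. t \<in> T \<Longrightarrow> a + t *\<^sub>R s \<in> V" "Ck_on k g V"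
  shows "Ck_on k (\<lambda>t::real. g (a + t *\<^sub>R s)) T"
  using assms(3)
proof (induction k arbitrary: g)
  case 0
  then have "continuous_on V g" by simp
  then show ?case
    by (auto intro!: continuous_intros continuous_on_compose2[of V g] assms(2))
next
  case (Suc k)
  have der: "((\<lambda>t. g (a + t *\<^sub>R s)) has_derivative
      (\<lambda>v. frechet_derivative g (at (a + t *\<^sub>R s)) (v *\<^sub>R s))) (at t)" if "t \<in> T" for t
  proof -
    have "(g has_derivative frechet_derivative g (at (a + t *\<^sub>R s))) (at (a + t *\<^sub>R s))"
      using Suc.prems assms(2)[OF that] by (simp flip: frechet_derivative_works)
    moreover have "((\<lambda>t. a + t *\<^sub>R s) has_derivative (\<lambda>v. v *\<^sub>R s)) (at t)"
      by (auto intro!: derivative_eq_intros)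
    ultimately show ?thesis
      using diff_chain_at by (fastforce simp: o_def)
  qed
  have "Ck_on k (\<lambda>t. frechet_derivative (\<lambda>t. g (a + t *\<^sub>R s)) (at t) v) T" for v
  proof (rule Ck_on_cong_open[OF assms(1)])
    show "Ck_on k (\<lambda>t. frechet_derivative g (at (a + t *\<^sub>R s)) (v *\<^sub>R s)) T"
      using Suc.prems by (intro Suc.IH) simp
  qed (simp add: frechet_derivative_at[OF der, symmetric])
  moreover have "(\<lambda>t. g (a + t *\<^sub>R s)) differentiable (at t)" if "t \<in> T" for t
    using der[OF that] by (auto simp: differentiable_def)
  ultimately show ?case by simp
qed

lemma smooth_on_differentiable: "smooth_on f S \<Longrightarrow> x \<in> S \<Longrightarrow> f differentiable (at x)"
  by (auto simp: smooth_on_def dest: spec[of _ "Suc 0"])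

text \<open>The definition by velocities of curves has no linear structure built in, whereas the
  surjectivity argument below counts dimensions. A slice chart straightens \<open>M\<close> to
  \<open>S\<close>; lines in \<open>S\<close> pull back under \<open>g\<close> to curves in
  \<open>M\<close>, so the image of \<open>S\<close> under the derivative of \<open>g\<close> serves
  as \<open>T\<close>.\<close>

lemma tangent_space_contains_subspace:
  fixes M :: "'a::euclidean_space set"
  assumes "smooth_submanifold d M" "p \<in> M"
  obtains T where "subspace T" "dim T = d" "T \<subseteq> tangent_space M p"
proof -
  obtain W V f g S where W: "open W" "p \<in> W" and V: "open (V :: 'a set)" and hom: "homeomorphism W V f g"
    and f: "smooth_on f W" and g: "smooth_on g V" and S: "subspace S" "dim S = d"
    and slice: "f ` (W \<inter> M) = V \<inter> S"
    using assms unfolding smooth_submanifold_def by meson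
  have fpV: "f p \<in> V" and fpS: "f p \<in> S" and gfp: "g (f p) = p"
    using slice W(2) assms(2) hom by (auto simp: homeomorphism_def)
  define L where "L = frechet_derivative g (at (f p))"
  have L: "(g has_derivative L) (at (f p))"
    using smooth_on_differentiable[OF g fpV] by (simp add: L_def frechet_derivative_works)
  then have linL: "linear L" by (rule has_derivative_linear)
  \<comment> \<open>Differentiating \<open>f (g y) = y\<close> on the open set \<open>V\<close>
    gives \<open>L\<close> a left inverse.\<close>
  have inj: "inj L"
  proof -
    have "(f has_derivative frechet_derivative f (at p)) (at (g (f p)))"
      using smooth_on_differentiable[OF f W(2)] by (simp add: gfp frechet_derivative_works)
    then have "(f \<circ> g has_derivative frechet_derivative f (at p) \<circ> L) (at (f p))"
      using L diff_chain_at by blast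
    then have "((\<lambda>y. y) has_derivative frechet_derivative f (at p) \<circ> L) (at (f p))"
      by (rule has_derivative_transform_within_open[OF _ V fpV])
        (use hom in \<open>auto simp: homeomorphism_def\<close>)
    then have "frechet_derivative f (at p) \<circ> L = (\<lambda>y. y)"
      using has_derivative_ident has_derivative_unique by blast
    then show ?thesis by (metis inj_on_id2 inj_on_imageI2)
  qed
  have "L s \<in> tangent_space M p" if s: "s \<in> S" for s
  proof -
    \<comment> \<open>The line through \<open>f p\<close> stays in \<open>V\<close> for short times,
      which fixes the interval of definition of the curve.\<close>
    have "open ((\<lambda>t::real. f p + t *\<^sub>R s) -` V)"
      using V by (intro open_vimage continuous_intros) auto
    then obtain e :: real where e: "0 < e" "ball 0 e \<subseteq> (\<lambda>t. f p + t *\<^sub>R s) -` V"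
      using fpV by (metis (no_types, lifting) add.right_neutral open_contains_ball scaleR_zero_left vimageI)
    have inV: "f p + t *\<^sub>R s \<in> V" if "t \<in> {-e<..<e}" for t
      using that e(2) by (auto simp: subset_iff dist_real_def)
    let ?\<gamma> = "\<lambda>t. g (f p + t *\<^sub>R s)"
    have "smooth_on ?\<gamma> {-e<..<e}"
      using g inV unfolding smooth_on_def by (metis Ck_on_compose_line open_greaterThanLessThan)
    moreover have "?\<gamma> ` {-e<..<e} \<subseteq> M"
    proof clarify
      fix t assume t: "t \<in> {-e<..<e}"
      have "f p + t *\<^sub>R s \<in> V \<inter> S"
        using inV[OF t] fpS s S(1) by (simp add: subspace_add subspace_scale)
      then obtain q where q: "q \<in> W" "q \<in> M" "f p + t *\<^sub>R s = f q"
        unfolding slice[symmetric] by blast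
      then show "?\<gamma> t \<in> M"
        using hom by (simp add: homeomorphism_def)
    qed
    moreover have "(?\<gamma> has_vector_derivative L s) (at 0)"
    proof -
      have "((\<lambda>t. f p + t *\<^sub>R s) has_derivative (\<lambda>t. t *\<^sub>R s)) (at 0)"
        by (auto intro!: derivative_eq_intros)
      then have "(g \<circ> (\<lambda>t. f p + t *\<^sub>R s) has_derivative L \<circ> (\<lambda>t. t *\<^sub>R s)) (at 0)"
        using L by (intro diff_chain_at) auto
      then show ?thesis
        by (simp add: has_vector_derivative_def o_def linear_cmul[OF linL])
    qed
    ultimately show ?thesis
      unfolding tangent_space_def using e(1) gfp by (intro CollectI exI[of _ ?\<gamma>] exI[of _ e]) simp
  qed
  moreover have "subspace (L ` S)"
    using linL S(1) by (rule linear_subspace_image)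
  moreover have "dim (L ` S) = d"
    using dim_image_eq[OF linL, of S] inj S(2) by (simp add: inj_on_subset)
  ultimately show ?thesis using that by blast
qed

text \<open>Bounded linearity bounds the quotients, so the supremum in \<open>onorm_on\<close> is a
  true upper bound. At \<open>v = 0\<close> the quotient carries no information and both sides
  vanish.\<close>

lemma onorm_on:
  assumes "bounded_linear f" "v \<in> V"
  shows "norm (f v) \<le> onorm_on V f * norm v"
proof (cases "v = 0")
  case True
  then show ?thesis using assms(1) by (simp add: linear_simps)
next
  case False
  have "bdd_above ((\<lambda>v. norm (f v) / norm v) ` V)"
    using le_onorm[OF assms(1)] by (intro bdd_aboveI2)
  then have "norm (f v) / norm v \<le> onorm_on V f"
    unfolding onorm_on_def using assms(2) by (intro cSUP_upper)
  then show ?thesis using False by (simp add: field_simps)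
qed

lemma sgn_eq_of_abs_diff_less:
  fixes a b :: real
  assumes "\<bar>a - b\<bar> < \<bar>b\<bar>"
  shows "sgn a = sgn b"
  using assms by (auto simp: sgn_real_def)

section \<open>Differentials and Jacobians in an atlas with bounded charts\<close>

locale bounded_ae_atlas =
  fixes M :: "(real ^ 'n::finite) set"
    and I :: "'i set"
    and A :: "'i \<Rightarrow> ('n, 'd::finite) ae_chart"
    and \<epsilon> \<eta> L\<^sub>E L\<^sub>E' L\<^sub>D L\<^sub>D' :: real
  assumes submanifold: "smooth_submanifold CARD('d) M"
    and atlas: "approx_ae_atlas M I A \<epsilon> \<eta>"
    and gap_pos: "0 < nondegeneracy_gap I A"
    and enc_onorm: "\<And>k p. k \<in> I \<Longrightarrow> p \<in> enc_dom (A k) \<Longrightarrow>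
           onorm (frechet_derivative (enc (A k)) (at p)) \<le> L\<^sub>E"
    and enc_onorm_diff: "\<And>k p q. k \<in> I \<Longrightarrow> p \<in> enc_dom (A k) \<Longrightarrow> q \<in> enc_dom (A k) \<Longrightarrow>
           onorm (\<lambda>v. frechet_derivative (enc (A k)) (at p) v - frechet_derivative (enc (A k)) (at q) v)
             \<le> L\<^sub>E' * norm (p - q)"
    and dec_onorm: "\<And>i z. i \<in> I \<Longrightarrow> z \<in> enc (A i) ` enc_dom (A i) \<Longrightarrow>
           onorm (frechet_derivative (dec (A i)) (at z)) \<le> L\<^sub>D"
    and dec_onorm_diff: "\<And>i z z'. i \<in> I \<Longrightarrow> z \<in> enc (A i) ` enc_dom (A i) \<Longrightarrow>
           z' \<in> enc (A i) ` enc_dom (A i) \<Longrightarrow>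
           onorm (\<lambda>v. frechet_derivative (dec (A i)) (at z) v - frechet_derivative (dec (A i)) (at z') v)
             \<le> L\<^sub>D' * norm (z - z')"
    and nbhds: "enlarged_nbhds I A \<epsilon> (L\<^sub>E * L\<^sub>D + 3)"
    and \<eta>_less_1: "\<eta> < 1"
begin

abbreviation "U i \<equiv> chart_dom (A i)"
abbreviation "dE k p \<equiv> frechet_derivative (enc (A k)) (at p)"
text \<open>The decoder differential is indexed by a point \<open>p\<close> of the ambient space
  instead of its code, since the decoder bounds are available only at codes of points of the encoder
  domain.\<close>

abbreviation "dD i p \<equiv> frechet_derivative (dec (A i)) (at (enc (A i) p))"
abbreviation "\<Phi> i \<equiv> dec (A i) \<circ> enc (A i)"
abbreviation "d\<Phi> i p \<equiv> frechet_derivative (\<Phi> i) (at p)"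
abbreviation "J \<equiv> transition_jac A"

lemma enc_has_derivative:
  assumes "k \<in> I" "p \<in> enc_dom (A k)"
  shows "(enc (A k) has_derivative dE k p) (at p)"
  using assms atlas by (simp add: approx_ae_atlas_def flip: frechet_derivative_works)

lemma dec_has_derivative:
  assumes "i \<in> I" "p \<in> enc_dom (A i)"
  shows "(dec (A i) has_derivative dD i p) (at (enc (A i) p))"
proof -
  have "enc (A i) p \<in> dec_dom (A i)" "Ck_on 1 (dec (A i)) (dec_dom (A i))"
    using assms atlas unfolding approx_ae_atlas_def by blast+
  then show ?thesis by (simp flip: frechet_derivative_works)
qed

lemma bounded_linear_dE: "k \<in> I \<Longrightarrow> p \<in> enc_dom (A k) \<Longrightarrow> bounded_linear (dE k p)"
  and bounded_linear_dD: "k \<in> I \<Longrightarrow> p \<in> enc_dom (A k) \<Longrightarrow> bounded_linear (dD k p)"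
  by (blast intro: enc_has_derivative dec_has_derivative has_derivative_bounded_linear)+

lemma norm_dE_le: "k \<in> I \<Longrightarrow> p \<in> enc_dom (A k) \<Longrightarrow> norm (dE k p v) \<le> L\<^sub>E * norm v"
  by (meson bounded_linear_dE enc_onorm mult_right_mono norm_ge_zero onorm order_trans)

lemma norm_dD_le: "k \<in> I \<Longrightarrow> p \<in> enc_dom (A k) \<Longrightarrow> norm (dD k p v) \<le> L\<^sub>D * norm v"
  by (meson bounded_linear_dD dec_onorm imageI mult_right_mono norm_ge_zero onorm order_trans)

lemma norm_dE_diff_le:
  assumes "k \<in> I" "p \<in> enc_dom (A k)" "q \<in> enc_dom (A k)"
  shows "norm (dE k p v - dE k q v) \<le> L\<^sub>E' * norm (p - q) * norm v"
proof -
  have "norm (dE k p v - dE k q v) \<le> onorm (\<lambda>v. dE k p v - dE k q v) * norm v"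
    using assms by (intro onorm bounded_linear_sub bounded_linear_dE)
  also have "\<dots> \<le> L\<^sub>E' * norm (p - q) * norm v"
    using assms by (intro mult_right_mono enc_onorm_diff) auto
  finally show ?thesis .
qed

lemma norm_dD_diff_le:
  assumes "k \<in> I" "p \<in> enc_dom (A k)" "q \<in> enc_dom (A k)"
  shows "norm (dD k p v - dD k q v) \<le> L\<^sub>D' * norm (enc (A k) p - enc (A k) q) * norm v"
proof -
  have "norm (dD k p v - dD k q v) \<le> onorm (\<lambda>v. dD k p v - dD k q v) * norm v"
    using assms by (intro onorm bounded_linear_sub bounded_linear_dD)
  also have "\<dots> \<le> L\<^sub>D' * norm (enc (A k) p - enc (A k) q) * norm v"
    using assms by (intro mult_right_mono dec_onorm_diff) auto
  finally show ?thesis .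
qed

lemma \<Phi>_has_derivative:
  assumes "i \<in> I" "p \<in> enc_dom (A i)"
  shows "(\<Phi> i has_derivative dD i p \<circ> dE i p) (at p)"
  using diff_chain_at[OF enc_has_derivative[OF assms] dec_has_derivative[OF assms]] .

lemma d\<Phi>_apply: "i \<in> I \<Longrightarrow> p \<in> enc_dom (A i) \<Longrightarrow> d\<Phi> i p v = dD i p (dE i p v)"
  using frechet_derivative_at[OF \<Phi>_has_derivative] by (metis comp_apply)

lemma linear_d\<Phi>: "i \<in> I \<Longrightarrow> p \<in> enc_dom (A i) \<Longrightarrow> linear (d\<Phi> i p)"
  by (metis \<Phi>_has_derivative frechet_derivative_at has_derivative_linear)

text \<open>The chain rule. It turns every estimate on Jacobian matrices into one on encoder and
  decoder differentials.\<close>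

lemma J_mult:
  assumes "i \<in> I" "j \<in> I" "p \<in> enc_dom (A i)" "\<Phi> i p \<in> enc_dom (A j)"
  shows "J j i p *v v = dE j (\<Phi> i p) (dD i p v)"
proof -
  have "(transition A j i has_derivative dE j (\<Phi> i p) \<circ> dD i p) (at (enc (A i) p))"
    unfolding transition_def
    using enc_has_derivative[OF assms(2,4)] dec_has_derivative[OF assms(1,3)]
    by (intro diff_chain_at) simp_all
  from frechet_derivative_at[OF this, symmetric] has_derivative_linear[OF this] show ?thesis
    unfolding transition_jac_def jacobian_def by (simp flip: linear_matrix_vector_mul_eq add: matrix_works)
qed

text \<open>The gap is an infimum over all overlaps. With \<open>c = 0\<close> this gives
  nonvanishing determinants; with \<open>c\<close> a perturbation bound it gives the room needed to
  compare signs.\<close>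

lemma abs_det_J_greater:
  assumes "i \<in> I" "j \<in> I" "x \<in> U i" "x \<in> U j" "ereal c < nondegeneracy_gap I A"
  shows "c < \<bar>det (J j i x)\<bar>"
proof -
  have "nondegeneracy_gap I A \<le> (INF x \<in> U i \<inter> U j. ereal \<bar>det (J j i x)\<bar>)"
    unfolding nondegeneracy_gap_def using assms by (intro INF_lower2[of "(i, j)"]) auto
  also have "\<dots> \<le> ereal \<bar>det (J j i x)\<bar>"
    using assms by (intro INF_lower) simp
  finally have "ereal c < ereal \<bar>det (J j i x)\<bar>" using assms(5) by (rule less_le_trans[rotated])
  then show ?thesis by simp
qed

end

section \<open>Lipschitz estimates near a point of the manifold\<close>

text \<open>The signs of the constants are not assumed; they are derived from a point of
  \<open>M\<close> lying in some chart, which is why one is fixed.\<close>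

locale bounded_ae_atlas_point = bounded_ae_atlas M I A \<epsilon> \<eta> L\<^sub>E L\<^sub>E' L\<^sub>D L\<^sub>D'
  for M :: "(real ^ 'n::finite) set"
    and I :: "'i set"
    and A :: "'i \<Rightarrow> ('n, 'd::finite) ae_chart"
    and \<epsilon> \<eta> L\<^sub>E L\<^sub>E' L\<^sub>D L\<^sub>D' :: real +
  fixes x :: "real ^ 'n"
  assumes x_in_M: "x \<in> M"
begin

text \<open>Each constant bounds a nonnegative quantity from above. For the Lipschitz constants this
  is informative only where the arguments differ: two points of the open encoder domain for
  \<open>L\<^sub>E'\<close>, two distinct codes for \<open>L\<^sub>D'\<close>, and the latter exist
  because the gap is positive.\<close>

lemma constants_nonneg: "0 \<le> \<epsilon>" "0 \<le> L\<^sub>E" "0 \<le> L\<^sub>E'" "0 \<le> L\<^sub>D" "0 \<le> L\<^sub>D'"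
proof -
  obtain i where i: "i \<in> I" "x \<in> U i"
    using atlas x_in_M by (auto simp: approx_ae_atlas_def)
  have O: "x \<in> enc_dom (A i)" "open (enc_dom (A i))" and close: "norm (\<Phi> i x - x) \<le> \<epsilon>"
    using atlas i by (auto simp: approx_ae_atlas_def)
  show "0 \<le> \<epsilon>" using close norm_ge_zero order_trans by blast
  show LE: "0 \<le> L\<^sub>E"
    using enc_onorm[OF i(1) O(1)] onorm_pos_le[OF bounded_linear_dE[OF i(1) O(1)]] by simp
  show LD: "0 \<le> L\<^sub>D"
    using dec_onorm[OF i(1) imageI[OF O(1)]] onorm_pos_le[OF bounded_linear_dD[OF i(1) O(1)]] by simp
  have "enc_dom (A i) \<noteq> {x}"
    using O(2) by (metis not_open_singleton)
  then obtain q where q: "q \<in> enc_dom (A i)" "q \<noteq> x" using O(1) by blast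
  have "0 \<le> onorm (\<lambda>v. dE i q v - dE i x v)"
    by (intro onorm_pos_le bounded_linear_sub bounded_linear_dE i q O)
  then have "0 \<le> L\<^sub>E' * norm (q - x)"
    using enc_onorm_diff[OF i(1) q(1) O(1)] by linarith
  then show "0 \<le> L\<^sub>E'" using q(2) by (simp add: zero_le_mult_iff)
  \<comment> \<open>Shown directly, because \<open>near_in_enc_dom\<close> below rests on the signs
    being proved here.\<close>
  have O': "\<Phi> i x \<in> enc_dom (A i)"
  proof -
    have "set_edist (\<Phi> i x) (U i) \<le> ereal (dist (\<Phi> i x) x)"
      unfolding set_edist_def using i by (intro INF_lower)
    also have "dist (\<Phi> i x) x \<le> 1 * \<epsilon>"
      using close by (simp add: dist_norm)
    also have "1 * \<epsilon> \<le> (L\<^sub>E * L\<^sub>D + 3) * \<epsilon>"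
      using LE LD \<open>0 \<le> \<epsilon>\<close> by (intro mult_right_mono) (simp_all add: add_increasing)
    finally show ?thesis using nbhds i by (auto simp: enlarged_nbhds_def)
  qed
  show "0 \<le> L\<^sub>D'"
  proof (rule ccontr)
    assume neg: "\<not> 0 \<le> L\<^sub>D'"
    \<comment> \<open>Then the encoder is constant, contradicting \<open>det (J i i x) \<noteq> 0\<close>.\<close>
    have "enc (A i) p = enc (A i) x" if p: "p \<in> enc_dom (A i)" for p
    proof -
      have "0 \<le> onorm (\<lambda>v. dD i p v - dD i x v)"
        by (intro onorm_pos_le bounded_linear_sub bounded_linear_dD i p O)
      then have "0 \<le> L\<^sub>D' * norm (enc (A i) p - enc (A i) x)"
        using dec_onorm_diff[OF i(1) imageI[OF p] imageI[OF O(1)]] by linarith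
      then show ?thesis using neg by (simp add: zero_le_mult_iff)
    qed
    then have "((\<lambda>_. enc (A i) x) has_derivative dE i (\<Phi> i x)) (at (\<Phi> i x))"
      using has_derivative_transform_within_open[OF enc_has_derivative[OF i(1) O'] O(2) O'] by simp
    then have "dE i (\<Phi> i x) = (\<lambda>_. 0)"
      using has_derivative_const has_derivative_unique by blast
    then have "J i i x *v v = 0 *v v" for v
      using J_mult[OF i(1) i(1) O(1) O'] by simp
    then have "J i i x = 0" unfolding matrix_eq by blast
    then have "det (J i i x) = 0" by (intro det_zero_row(2)) (simp add: row_def vec_eq_iff)
    moreover have "0 < \<bar>det (J i i x)\<bar>"
      using gap_pos i by (intro abs_det_J_greater) (simp_all flip: zero_ereal_def)
    ultimately show False by simp
  qed
qed

lemma ball_subset_enc_dom: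
  assumes "i \<in> I" "x \<in> U i" "norm (p - x) \<le> (L\<^sub>E * L\<^sub>D + 3) * \<epsilon>"
  shows "p \<in> enc_dom (A i)"
proof -
  have "set_edist p (U i) \<le> ereal (dist p x)"
    unfolding set_edist_def using assms by (intro INF_lower)
  also have "\<dots> \<le> ereal ((L\<^sub>E * L\<^sub>D + 3) * \<epsilon>)"
    using assms(3) by (simp add: dist_norm)
  finally show ?thesis using nbhds assms by (auto simp: enlarged_nbhds_def)
qed

lemma \<epsilon>_le_radius: "\<epsilon> \<le> (L\<^sub>E * L\<^sub>D + 3) * \<epsilon>"
  using mult_right_mono[of 1 "L\<^sub>E * L\<^sub>D + 3" \<epsilon>] constants_nonneg by (simp add: add_increasing)

lemma near_in_enc_dom: "i \<in> I \<Longrightarrow> x \<in> U i \<Longrightarrow> norm (p - x) \<le> \<epsilon> \<Longrightarrow> p \<in> enc_dom (A i)"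
  using ball_subset_enc_dom \<epsilon>_le_radius order_trans by blast

lemma norm_\<Phi>_diff_self_le: "i \<in> I \<Longrightarrow> x \<in> U i \<Longrightarrow> norm (\<Phi> i x - x) \<le> \<epsilon>"
  using atlas by (simp add: approx_ae_atlas_def)

text \<open>The mean value inequality. The convex set \<open>S\<close> stays free: the sign
  comparison uses the closed ball of radius \<epsilon>, local constancy an arbitrarily small
  ball.\<close>

lemma norm_enc_diff_le:
  assumes "i \<in> I" "convex S" "S \<subseteq> enc_dom (A i)" "p \<in> S" "q \<in> S"
  shows "norm (enc (A i) p - enc (A i) q) \<le> L\<^sub>E * norm (p - q)"
  using assms
  by (intro differentiable_bound[of S _ "dE i"])
    (auto intro: has_derivative_at_withinI enc_has_derivative enc_onorm)

lemma norm_\<Phi>_diff_le: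
  assumes "i \<in> I" "convex S" "S \<subseteq> enc_dom (A i)" "p \<in> S" "q \<in> S"
  shows "norm (\<Phi> i p - \<Phi> i q) \<le> L\<^sub>E * L\<^sub>D * norm (p - q)"
proof (rule differentiable_bound[of S _ "\<lambda>p. dD i p \<circ> dE i p"])
  fix y assume "y \<in> S"
  then have y: "y \<in> enc_dom (A i)" using assms by blast
  then show "(\<Phi> i has_derivative dD i y \<circ> dE i y) (at y within S)"
    using \<Phi>_has_derivative assms(1) has_derivative_at_withinI by blast
  have "onorm (dD i y \<circ> dE i y) \<le> onorm (dD i y) * onorm (dE i y)"
    using assms(1) y by (intro onorm_compose bounded_linear_dE bounded_linear_dD)
  also have "\<dots> \<le> L\<^sub>D * L\<^sub>E"
    using assms(1) y constants_nonneg
    by (intro mult_mono enc_onorm dec_onorm onorm_pos_le bounded_linear_dE) auto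
  finally show "onorm (dD i y \<circ> dE i y) \<le> L\<^sub>E * L\<^sub>D" by (simp add: mult.commute)
qed (use assms in auto)

lemma cball_\<epsilon>_subset: "i \<in> I \<Longrightarrow> x \<in> U i \<Longrightarrow> cball x \<epsilon> \<subseteq> enc_dom (A i)"
  using near_in_enc_dom by (auto simp: dist_norm norm_minus_commute)

lemma norm_enc_near_le:
  assumes "i \<in> I" "x \<in> U i" "norm (p - x) \<le> \<epsilon>"
  shows "norm (enc (A i) p - enc (A i) x) \<le> L\<^sub>E * \<epsilon>"
proof -
  have "norm (enc (A i) p - enc (A i) x) \<le> L\<^sub>E * norm (p - x)"
    using assms constants_nonneg cball_\<epsilon>_subset
    by (intro norm_enc_diff_le[of i "cball x \<epsilon>"]) (auto simp: dist_norm norm_minus_commute)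
  also have "\<dots> \<le> L\<^sub>E * \<epsilon>" using assms constants_nonneg by (intro mult_left_mono)
  finally show ?thesis .
qed

lemma norm_\<Phi>_near_le:
  assumes "i \<in> I" "x \<in> U i" "norm (p - x) \<le> \<epsilon>"
  shows "norm (\<Phi> i p - \<Phi> i x) \<le> L\<^sub>E * L\<^sub>D * \<epsilon>"
proof -
  have "norm (\<Phi> i p - \<Phi> i x) \<le> L\<^sub>E * L\<^sub>D * norm (p - x)"
    using assms constants_nonneg cball_\<epsilon>_subset
    by (intro norm_\<Phi>_diff_le[of i "cball x \<epsilon>"]) (auto simp: dist_norm norm_minus_commute)
  also have "\<dots> \<le> L\<^sub>E * L\<^sub>D * \<epsilon>" using assms constants_nonneg by (intro mult_left_mono) auto
  finally show ?thesis .
qed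

text \<open>Through \<open>\<Phi> j x\<close>: a Lipschitz error
  \<open>L\<^sub>E * L\<^sub>D * \<epsilon>\<close> and one reconstruction error \<epsilon>. A
  second reconstruction thus stays within the radius
  \<open>(L\<^sub>E * L\<^sub>D + 3) * \<epsilon>\<close> on which all encoders around
  \<open>x\<close> are defined.\<close>

lemma norm_\<Phi>_near_diff_center_le:
  assumes "j \<in> I" "x \<in> U j" "norm (p - x) \<le> \<epsilon>"
  shows "norm (\<Phi> j p - x) \<le> (L\<^sub>E * L\<^sub>D + 1) * \<epsilon>"
proof -
  have "norm (\<Phi> j p - x) \<le> norm (\<Phi> j p - \<Phi> j x) + norm (\<Phi> j x - x)"
    using norm_triangle_ineq[of "\<Phi> j p - \<Phi> j x" "\<Phi> j x - x"] by simp
  then show ?thesis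
    using norm_\<Phi>_near_le[OF assms] norm_\<Phi>_diff_self_le[OF assms(1,2)] by (simp add: algebra_simps)
qed

lemma \<Phi>_near_in_enc_dom:
  assumes "j \<in> I" "x \<in> U j" "k \<in> I" "x \<in> U k" "norm (p - x) \<le> \<epsilon>"
  shows "\<Phi> j p \<in> enc_dom (A k)"
  using assms(3,4)
proof (rule ball_subset_enc_dom)
  show "norm (\<Phi> j p - x) \<le> (L\<^sub>E * L\<^sub>D + 3) * \<epsilon>"
    using norm_\<Phi>_near_diff_center_le[OF assms(1,2,5)] constants_nonneg
    by (simp add: algebra_simps)
qed

text \<open>First the decoder differential is moved, its code shifting by at most
  \<open>L\<^sub>E * \<epsilon>\<close>, then the encoder differential. The two errors make up the
  constant \<open>L\<^sub>\<Phi>'\<close> of the theorem.\<close>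

lemma norm_d\<Phi>_near_diff_le:
  assumes j: "j \<in> I" "x \<in> U j" and p: "norm (p - x) \<le> \<epsilon>"
  shows "norm (d\<Phi> j p v - d\<Phi> j x v) \<le> (L\<^sub>D' * L\<^sub>E ^ 2 + L\<^sub>D * L\<^sub>E') * \<epsilon> * norm v"
proof -
  have O: "x \<in> enc_dom (A j)" "p \<in> enc_dom (A j)"
    using near_in_enc_dom[OF j] p constants_nonneg by auto
  have "d\<Phi> j p v - d\<Phi> j x v =
      (dD j p (dE j p v) - dD j x (dE j p v)) + dD j x (dE j p v - dE j x v)"
    using j O by (simp add: d\<Phi>_apply linear_diff[OF bounded_linear.linear[OF bounded_linear_dD]])
  then have "norm (d\<Phi> j p v - d\<Phi> j x v) \<le>
      norm (dD j p (dE j p v) - dD j x (dE j p v)) + norm (dD j x (dE j p v - dE j x v))"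
    by (simp only: norm_triangle_ineq)
  also have "\<dots> \<le> L\<^sub>D' * (L\<^sub>E * \<epsilon>) * (L\<^sub>E * norm v) + L\<^sub>D * (L\<^sub>E' * \<epsilon> * norm v)"
  proof (rule add_mono)
    have "norm (dD j p (dE j p v) - dD j x (dE j p v))
        \<le> L\<^sub>D' * norm (enc (A j) p - enc (A j) x) * norm (dE j p v)"
      using j O by (intro norm_dD_diff_le)
    also have "\<dots> \<le> L\<^sub>D' * (L\<^sub>E * \<epsilon>) * (L\<^sub>E * norm v)"
      using j O p constants_nonneg
      by (intro mult_mono norm_enc_near_le norm_dE_le mult_nonneg_nonneg) auto
    finally show "norm (dD j p (dE j p v) - dD j x (dE j p v)) \<le> L\<^sub>D' * (L\<^sub>E * \<epsilon>) * (L\<^sub>E * norm v)" .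
    have "norm (dD j x (dE j p v - dE j x v)) \<le> L\<^sub>D * norm (dE j p v - dE j x v)"
      using j O by (intro norm_dD_le)
    also have "norm (dE j p v - dE j x v) \<le> L\<^sub>E' * norm (p - x) * norm v"
      using j O by (intro norm_dE_diff_le)
    also have "L\<^sub>E' * norm (p - x) * norm v \<le> L\<^sub>E' * \<epsilon> * norm v"
      using p constants_nonneg by (intro mult_mono) auto
    finally show "norm (dD j x (dE j p v - dE j x v)) \<le> L\<^sub>D * (L\<^sub>E' * \<epsilon> * norm v)"
      using constants_nonneg by (auto simp: mult_left_mono)
  qed
  finally show ?thesis by (simp add: algebra_simps power2_eq_square)
qed

lemma norm_J_le:
  assumes "i \<in> I" "j \<in> I" "p \<in> enc_dom (A i)" "\<Phi> i p \<in> enc_dom (A j)"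
  shows "norm (J j i p *v v) \<le> L\<^sub>E * L\<^sub>D * norm v"
proof -
  have "norm (J j i p *v v) \<le> L\<^sub>E * norm (dD i p v)"
    unfolding J_mult[OF assms] using assms by (intro norm_dE_le)
  also have "\<dots> \<le> L\<^sub>E * (L\<^sub>D * norm v)"
    using assms constants_nonneg by (intro mult_left_mono norm_dD_le)
  finally show ?thesis by (simp add: mult.assoc)
qed

text \<open>The base point of the encoder differential moves by at most
  \<open>L\<^sub>E * L\<^sub>D * norm (p - q)\<close> and that of the decoder differential by
  \<open>L\<^sub>E * norm (p - q)\<close>; together they give the constant
  \<open>C\<^sub>g\<close>.\<close>

lemma norm_J_diff_le:
  assumes "j \<in> I" "k \<in> I" and S: "convex S" "S \<subseteq> enc_dom (A j)" "p \<in> S" "q \<in> S"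
    and "\<Phi> j p \<in> enc_dom (A k)" "\<Phi> j q \<in> enc_dom (A k)"
  shows "norm (J k j p *v v - J k j q *v v)
    \<le> L\<^sub>E * (L\<^sub>E * L\<^sub>D' + L\<^sub>E' * L\<^sub>D ^ 2) * norm (p - q) * norm v"
proof -
  have O: "p \<in> enc_dom (A j)" "q \<in> enc_dom (A j)" using S by auto
  have "J k j p *v v - J k j q *v v =
      (dE k (\<Phi> j p) (dD j p v) - dE k (\<Phi> j q) (dD j p v)) + dE k (\<Phi> j q) (dD j p v - dD j q v)"
    using assms O by (simp add: J_mult linear_diff[OF bounded_linear.linear[OF bounded_linear_dE]])
  then have "norm (J k j p *v v - J k j q *v v) \<le>
      norm (dE k (\<Phi> j p) (dD j p v) - dE k (\<Phi> j q) (dD j p v)) + norm (dE k (\<Phi> j q) (dD j p v - dD j q v))"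
    by (simp only: norm_triangle_ineq)
  also have "\<dots> \<le> L\<^sub>E' * (L\<^sub>E * L\<^sub>D * norm (p - q)) * (L\<^sub>D * norm v)
      + L\<^sub>E * (L\<^sub>D' * (L\<^sub>E * norm (p - q)) * norm v)"
  proof (rule add_mono)
    have "norm (dE k (\<Phi> j p) (dD j p v) - dE k (\<Phi> j q) (dD j p v))
        \<le> L\<^sub>E' * norm (\<Phi> j p - \<Phi> j q) * norm (dD j p v)"
      using assms by (intro norm_dE_diff_le)
    also have "\<dots> \<le> L\<^sub>E' * (L\<^sub>E * L\<^sub>D * norm (p - q)) * (L\<^sub>D * norm v)"
      using assms O constants_nonneg
      by (intro mult_mono norm_\<Phi>_diff_le[of _ S] norm_dD_le mult_nonneg_nonneg) auto
    finally show "norm (dE k (\<Phi> j p) (dD j p v) - dE k (\<Phi> j q) (dD j p v))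
        \<le> L\<^sub>E' * (L\<^sub>E * L\<^sub>D * norm (p - q)) * (L\<^sub>D * norm v)" .
    have "norm (dE k (\<Phi> j q) (dD j p v - dD j q v)) \<le> L\<^sub>E * norm (dD j p v - dD j q v)"
      using assms by (intro norm_dE_le)
    also have "\<dots> \<le> L\<^sub>E * (L\<^sub>D' * norm (enc (A j) p - enc (A j) q) * norm v)"
      using assms O constants_nonneg by (intro mult_left_mono norm_dD_diff_le)
    also have "\<dots> \<le> L\<^sub>E * (L\<^sub>D' * (L\<^sub>E * norm (p - q)) * norm v)"
      using assms constants_nonneg
      by (intro mult_left_mono mult_right_mono norm_enc_diff_le[of _ S]) auto
    finally show "norm (dE k (\<Phi> j q) (dD j p v - dD j q v))
        \<le> L\<^sub>E * (L\<^sub>D' * (L\<^sub>E * norm (p - q)) * norm v)" .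
  qed
  finally show ?thesis by (simp add: algebra_simps power2_eq_square)
qed

text \<open>The radius \<open>r\<close> is kept apart from \<epsilon>: \<open>r = \<epsilon>\<close>
  yields \<open>K\<^sub>d\<^sub>e\<^sub>t\<close>, and \<open>r\<close> equal to the distance of the
  points yields continuity of the determinant.\<close>

lemma abs_det_J_diff_le:
  assumes "j \<in> I" "k \<in> I" "convex S" "S \<subseteq> enc_dom (A j)" "p \<in> S" "q \<in> S"
    and "\<Phi> j p \<in> enc_dom (A k)" "\<Phi> j q \<in> enc_dom (A k)" and r: "norm (p - q) \<le> r"
    and C: "C = L\<^sub>E * (L\<^sub>E * L\<^sub>D' + L\<^sub>E' * L\<^sub>D ^ 2)"
  shows "\<bar>det (J k j p) - det (J k j q)\<bar>
    \<le> real CARD('d) * (C * r) * (L\<^sub>E * L\<^sub>D + C * r) ^ (CARD('d) - 1)"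
proof (rule det_diff_le)
  show "norm (J k j q *v v) \<le> L\<^sub>E * L\<^sub>D * norm v" for v
    using assms by (intro norm_J_le) auto
  have "0 \<le> C" using C constants_nonneg by simp
  show "norm (J k j p *v v - J k j q *v v) \<le> C * r * norm v" for v
  proof -
    have "norm (J k j p *v v - J k j q *v v) \<le> C * norm (p - q) * norm v"
      unfolding C using assms by (intro norm_J_diff_le)
    also have "\<dots> \<le> C * r * norm v"
      using \<open>0 \<le> C\<close> by (intro mult_right_mono mult_left_mono r) auto
    finally show ?thesis .
  qed
qed

section \<open>Reconstruction differentials on tangent and decoder directions\<close>

lemma norm_d\<Phi>_tangent_diff_le:
  assumes "i \<in> I" "x \<in> U i" "w \<in> tangent_space M x"
  shows "norm (d\<Phi> i x w - w) \<le> \<eta> * norm w"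
proof -
  have O: "x \<in> enc_dom (A i)" using near_in_enc_dom[OF assms(1,2)] constants_nonneg by simp
  have "bounded_linear (\<lambda>v. d\<Phi> i x v - v)"
    using linear_d\<Phi>[OF assms(1) O]
    by (intro bounded_linear_sub bounded_linear_ident) (simp add: linear_conv_bounded_linear)
  then have "norm (d\<Phi> i x w - w) \<le> onorm_on (tangent_space M x) (\<lambda>v. d\<Phi> i x v - v) * norm w"
    using assms(3) by (rule onorm_on)
  also have "\<dots> \<le> \<eta> * norm w"
    using atlas assms by (intro mult_right_mono) (auto simp: approx_ae_atlas_def)
  finally show ?thesis .
qed

text \<open>Since \<open>CARD('d)\<close> is positive there is a nonzero tangent vector on which to
  test the bound.\<close>

lemma \<eta>_nonneg: "0 \<le> \<eta>"
proof -
  obtain i where i: "i \<in> I" "x \<in> U i"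
    using atlas x_in_M by (auto simp: approx_ae_atlas_def)
  obtain T where T: "subspace T" "dim T = CARD('d)" "T \<subseteq> tangent_space M x"
    using tangent_space_contains_subspace[OF submanifold x_in_M] .
  have "\<not> T \<subseteq> {0}" using T(2) by (metis dim_eq_0 zero_less_card_finite less_irrefl)
  then obtain w where w: "w \<in> T" "w \<noteq> 0" by blast
  have "0 \<le> \<eta> * norm w"
    using norm_d\<Phi>_tangent_diff_le[OF i, of w] w T(3) order_trans[OF norm_ge_zero] by blast
  then show ?thesis using w by (simp add: zero_le_mult_iff)
qed

text \<open>As \<open>\<eta> < 1\<close>, \<open>dE i x\<close> is injective on the \<open>d\<close>-dimensional tangent space, hence onto.\<close>

lemma dE_tangent_surj:
  assumes "i \<in> I" "x \<in> U i"
  obtains w where "w \<in> tangent_space M x" "dE i x w = v"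
proof -
  have O: "x \<in> enc_dom (A i)" using near_in_enc_dom[OF assms(1,2)] constants_nonneg by simp
  obtain T where T: "subspace T" "dim T = CARD('d)" "T \<subseteq> tangent_space M x"
    using tangent_space_contains_subspace[OF submanifold x_in_M] .
  have lin: "linear (dE i x)" using bounded_linear_dE[OF assms(1) O] bounded_linear.linear by blast
  have ker: "w = 0" if w: "w \<in> T" "dE i x w = 0" for w
  proof (rule ccontr)
    assume "w \<noteq> 0"
    have "d\<Phi> i x w = 0"
      using w(2) linear_0[OF bounded_linear.linear[OF bounded_linear_dD[OF assms(1) O]]]
      by (simp add: d\<Phi>_apply[OF assms(1) O])
    \<comment> \<open>The tangent estimate now compares \<open>w\<close> with 0.\<close>
    then have "norm w \<le> \<eta> * norm w"
      using norm_d\<Phi>_tangent_diff_le[OF assms, of w] w T(3) by auto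
    then show False using \<open>w \<noteq> 0\<close> \<eta>_less_1 by simp
  qed
  have inj: "inj_on (dE i x) T"
    using linear_inj_on_iff_eq_0[OF lin T(1)] ker by blast
  \<comment> \<open>\<open>dim_image_eq\<close> asks for injectivity on the span of
    \<open>T\<close>, which is \<open>T\<close> itself.\<close>
  then have "dim (dE i x ` T) = DIM(real ^ 'd)"
    using dim_image_eq[OF lin, of T] T(2) inj span_eq_iff[THEN iffD2, OF T(1)] by simp
  then have "dE i x ` T = UNIV"
    using linear_subspace_image[OF lin T(1)] dim_eq_full span_eq_iff by metis
  then show ?thesis using that T(3) by (metis UNIV_I image_iff subsetD)
qed

text \<open>The vector \<open>u = dD i x v\<close> need not be tangent to \<open>M\<close>, so the
  tangent estimate for chart \<open>j\<close> is applied to a tangent \<open>w\<close> with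
  \<open>d\<Phi> i x w = u\<close>. It costs \<open>\<eta> * norm w\<close> on \<open>w\<close> and
  at most \<open>(L\<^sub>E * L\<^sub>D + 1) * \<eta> * norm w\<close> on \<open>u - w\<close>,
  while \<open>norm w\<close> is at most \<open>norm u / (1 - \<eta>)\<close>.\<close>

lemma norm_d\<Phi>_dD_diff_le:
  assumes i: "i \<in> I" "x \<in> U i" and j: "j \<in> I" "x \<in> U j"
  shows "norm (d\<Phi> j x (dD i x v) - dD i x v) \<le> (L\<^sub>E * L\<^sub>D + 2) * \<eta> / (1 - \<eta>) * norm (dD i x v)"
proof -
  have O: "x \<in> enc_dom (A i)" "x \<in> enc_dom (A j)"
    using near_in_enc_dom i j constants_nonneg by simp_all
  obtain w where w: "w \<in> tangent_space M x" "dE i x w = v"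
    using dE_tangent_surj[OF i] .
  define u where "u = dD i x v"
  have uw: "norm (u - w) \<le> \<eta> * norm w"
    using norm_d\<Phi>_tangent_diff_le[OF i w(1)] by (simp add: d\<Phi>_apply[OF i(1) O(1)] w(2) u_def)
  have "(1 - \<eta>) * norm w \<le> norm u"
    using uw norm_triangle_sub[of w u] by (simp add: norm_minus_commute algebra_simps)
  then have w_le: "norm w \<le> norm u / (1 - \<eta>)"
    using \<eta>_less_1 by (simp add: field_simps)
  have "d\<Phi> j x u - u = (d\<Phi> j x w - w) + (d\<Phi> j x (u - w) - (u - w))"
    by (simp add: linear_diff[OF linear_d\<Phi>[OF j(1) O(2)]])
  then have "norm (d\<Phi> j x u - u) \<le> norm (d\<Phi> j x w - w) + norm (d\<Phi> j x (u - w) - (u - w))"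
    by (simp only: norm_triangle_ineq)
  also have "\<dots> \<le> norm (d\<Phi> j x w - w) + (norm (d\<Phi> j x (u - w)) + norm (u - w))"
    by (intro add_left_mono norm_triangle_ineq4)
  also have "\<dots> \<le> \<eta> * norm w + (L\<^sub>E * L\<^sub>D * (\<eta> * norm w) + \<eta> * norm w)"
  proof (intro add_mono uw norm_d\<Phi>_tangent_diff_le[OF j w(1)])
    have "norm (d\<Phi> j x (u - w)) \<le> L\<^sub>D * norm (dE j x (u - w))"
      unfolding d\<Phi>_apply[OF j(1) O(2)] by (intro norm_dD_le j O)
    also have "\<dots> \<le> L\<^sub>D * (L\<^sub>E * norm (u - w))"
      by (intro mult_left_mono norm_dE_le j O constants_nonneg)
    also have "\<dots> \<le> L\<^sub>D * (L\<^sub>E * (\<eta> * norm w))"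
      by (intro mult_left_mono uw constants_nonneg)
    finally show "norm (d\<Phi> j x (u - w)) \<le> L\<^sub>E * L\<^sub>D * (\<eta> * norm w)" by (simp add: mult_ac)
  qed
  also have "\<dots> = (L\<^sub>E * L\<^sub>D + 2) * \<eta> * norm w" by (simp add: algebra_simps)
  also have "\<dots> \<le> (L\<^sub>E * L\<^sub>D + 2) * \<eta> * (norm u / (1 - \<eta>))"
    using constants_nonneg \<eta>_nonneg by (intro mult_left_mono w_le) auto
  finally show ?thesis by (simp add: u_def)
qed

text \<open>Moving the base point from \<open>x\<close> to \<open>p\<close> adds the \<epsilon>
  term; the total factor is \<open>\<eta>\<^sub>e\<^sub>f\<^sub>f\<close>.\<close>

lemma norm_d\<Phi>_near_dD_diff_le:
  assumes i: "i \<in> I" "x \<in> U i" and j: "j \<in> I" "x \<in> U j" and p: "norm (p - x) \<le> \<epsilon>"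
  shows "norm (d\<Phi> j p (dD i x v) - dD i x v)
    \<le> ((L\<^sub>E * L\<^sub>D + 2) * \<eta> / (1 - \<eta>) + (L\<^sub>D' * L\<^sub>E ^ 2 + L\<^sub>D * L\<^sub>E') * \<epsilon>) * norm (dD i x v)"
proof -
  define u where "u = dD i x v"
  have "norm (d\<Phi> j p u - u) \<le> norm (d\<Phi> j p u - d\<Phi> j x u) + norm (d\<Phi> j x u - u)"
    using norm_triangle_ineq[of "d\<Phi> j p u - d\<Phi> j x u" "d\<Phi> j x u - u"] by simp
  also have "\<dots> \<le> (L\<^sub>D' * L\<^sub>E ^ 2 + L\<^sub>D * L\<^sub>E') * \<epsilon> * norm u
      + (L\<^sub>E * L\<^sub>D + 2) * \<eta> / (1 - \<eta>) * norm u"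
    unfolding u_def by (intro add_mono norm_d\<Phi>_near_diff_le norm_d\<Phi>_dD_diff_le i j p)
  finally show ?thesis by (simp add: u_def distrib_right)
qed

section \<open>Composition of Jacobians and multiplicativity of signs\<close>

text \<open>With \<open>u = dD i x v\<close>, the product acts as
  \<open>dE k q (d\<Phi> j p u)\<close> and the direct transition as \<open>dE k p u\<close>. The
  two summands of \<Gamma> account for the change of the argument and for the shift of the base
  point from \<open>p\<close> to \<open>q\<close>.\<close>

lemma norm_J_composition_diff_le:
  assumes i: "i \<in> I" "x \<in> U i" and j: "j \<in> I" "x \<in> U j" and k: "k \<in> I" "x \<in> U k"
    and \<eta>e: "\<eta>e = (L\<^sub>E * L\<^sub>D + 2) * \<eta> / (1 - \<eta>) + (L\<^sub>D' * L\<^sub>E ^ 2 + L\<^sub>D * L\<^sub>E') * \<epsilon>"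
    and \<Gamma>: "\<Gamma> = L\<^sub>E * \<eta>e * L\<^sub>D + L\<^sub>E' * ((L\<^sub>E * L\<^sub>D + 2) * \<epsilon>) * (1 + \<eta>e) * L\<^sub>D"
  shows "norm ((J k j (\<Phi> i x) ** J j i x) *v v - J k i x *v v) \<le> \<Gamma> * norm v"
proof -
  define p where "p = \<Phi> i x"
  define q where "q = \<Phi> j p"
  define u where "u = dD i x v"
  have O: "x \<in> enc_dom (A i)" and px: "norm (p - x) \<le> \<epsilon>"
    using near_in_enc_dom[OF i] norm_\<Phi>_diff_self_le[OF i] constants_nonneg by (simp_all add: p_def)
  have pO: "p \<in> enc_dom (A j)" "p \<in> enc_dom (A k)"
    using near_in_enc_dom j k px by simp_all
  have qO: "q \<in> enc_dom (A k)" and qx: "norm (q - x) \<le> (L\<^sub>E * L\<^sub>D + 1) * \<epsilon>"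
    unfolding q_def using \<Phi>_near_in_enc_dom j k px norm_\<Phi>_near_diff_center_le by blast+
  have qp: "norm (q - p) \<le> (L\<^sub>E * L\<^sub>D + 2) * \<epsilon>"
    using qx px norm_triangle_ineq4[of "q - x" "p - x"] by (simp add: algebra_simps)
  have \<eta>e_nonneg: "0 \<le> \<eta>e"
    unfolding \<eta>e using constants_nonneg \<eta>_nonneg \<eta>_less_1 by simp
  have "(J k j p ** J j i x) *v v = dE k q (d\<Phi> j p u)"
    using i j k O pO qO
    by (simp flip: matrix_vector_mul_assoc add: J_mult d\<Phi>_apply u_def p_def q_def)
  moreover have "J k i x *v v = dE k p u"
    using i k O pO by (simp add: J_mult u_def p_def)
  ultimately have "(J k j p ** J j i x) *v v - J k i x *v v
      = dE k q (d\<Phi> j p u - u) + (dE k q u - dE k p u)"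
    using linear_diff[OF bounded_linear.linear[OF bounded_linear_dE[OF k(1) qO]]] by simp
  then have "norm ((J k j p ** J j i x) *v v - J k i x *v v)
      \<le> norm (dE k q (d\<Phi> j p u - u)) + norm (dE k q u - dE k p u)"
    by (simp only: norm_triangle_ineq)
  also have "\<dots> \<le> L\<^sub>E * norm (d\<Phi> j p u - u) + L\<^sub>E' * norm (q - p) * norm u"
    by (intro add_mono norm_dE_le norm_dE_diff_le k qO pO)
  also have "\<dots> \<le> L\<^sub>E * (\<eta>e * norm u) + L\<^sub>E' * ((L\<^sub>E * L\<^sub>D + 2) * \<epsilon>) * norm u"
    using norm_d\<Phi>_near_dD_diff_le[OF i j px] constants_nonneg qp
    by (intro add_mono mult_left_mono mult_right_mono) (auto simp: u_def \<eta>e)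
  \<comment> \<open>The factor 1 is inserted so that the next step can enlarge it to
    \<open>1 + \<eta>e\<close>, the form that \<Gamma> prescribes.\<close>
  also have "\<dots> = (L\<^sub>E * \<eta>e + L\<^sub>E' * ((L\<^sub>E * L\<^sub>D + 2) * \<epsilon>) * 1) * norm u"
    by (simp add: algebra_simps)
  also have "\<dots> \<le> (L\<^sub>E * \<eta>e + L\<^sub>E' * ((L\<^sub>E * L\<^sub>D + 2) * \<epsilon>) * (1 + \<eta>e)) * (L\<^sub>D * norm v)"
    unfolding u_def using constants_nonneg \<eta>e_nonneg
    by (intro mult_mono add_mono mult_left_mono norm_dD_le i O add_nonneg_nonneg mult_nonneg_nonneg)
      auto
  finally show ?thesis by (simp add: p_def \<Gamma> algebra_simps)
qed

text \<open>The point \<open>p\<close> may lie off \<open>M\<close>, where the gap says nothing.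
  Both comparisons are therefore made against determinants at \<open>x\<close>, and the product rule
  is applied to the matrices taken at \<open>p\<close> and \<open>x\<close>.\<close>

lemma transition_sign_mult:
  assumes i: "i \<in> I" "x \<in> U i" and j: "j \<in> I" "x \<in> U j" and k: "k \<in> I" "x \<in> U k"
    and "\<eta>e = (L\<^sub>E * L\<^sub>D + 2) * \<eta> / (1 - \<eta>) + (L\<^sub>D' * L\<^sub>E ^ 2 + L\<^sub>D * L\<^sub>E') * \<epsilon>"
    and "\<Gamma> = L\<^sub>E * \<eta>e * L\<^sub>D + L\<^sub>E' * ((L\<^sub>E * L\<^sub>D + 2) * \<epsilon>) * (1 + \<eta>e) * L\<^sub>D"
    and C: "C = L\<^sub>E * (L\<^sub>E * L\<^sub>D' + L\<^sub>E' * L\<^sub>D ^ 2)"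
    and \<Gamma>_gap: "ereal (real CARD('d) * \<Gamma> * (L\<^sub>E * L\<^sub>D + \<Gamma>) ^ (CARD('d) - 1)) < nondegeneracy_gap I A"
    and C_gap: "ereal (real CARD('d) * (C * \<epsilon>) * (L\<^sub>E * L\<^sub>D + C * \<epsilon>) ^ (CARD('d) - 1))
      < nondegeneracy_gap I A"
  shows "transition_sign A k i x = transition_sign A k j x * transition_sign A j i x"
proof -
  define p where "p = \<Phi> i x"
  have px: "norm (p - x) \<le> \<epsilon>" and x: "x \<in> enc_dom (A i)" "\<Phi> i x \<in> enc_dom (A k)"
    using norm_\<Phi>_diff_self_le[OF i] near_in_enc_dom \<Phi>_near_in_enc_dom i k constants_nonneg
    by (simp_all add: p_def)
  have "\<bar>det (J k j p) - det (J k j x)\<bar>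
      \<le> real CARD('d) * (C * \<epsilon>) * (L\<^sub>E * L\<^sub>D + C * \<epsilon>) ^ (CARD('d) - 1)"
    using px constants_nonneg \<Phi>_near_in_enc_dom[OF j k] cball_\<epsilon>_subset[OF j] j k C
    by (intro abs_det_J_diff_le[of j k "cball x \<epsilon>"]) (auto simp: dist_norm norm_minus_commute)
  also have "\<dots> < \<bar>det (J k j x)\<bar>"
    using abs_det_J_greater[OF _ _ _ _ C_gap] j k by blast
  finally have 1: "sgn (det (J k j p)) = sgn (det (J k j x))"
    by (rule sgn_eq_of_abs_diff_less)
  have "\<bar>det (J k j p ** J j i x) - det (J k i x)\<bar>
      \<le> real CARD('d) * \<Gamma> * (L\<^sub>E * L\<^sub>D + \<Gamma>) ^ (CARD('d) - 1)"
    unfolding p_def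
    using assms x by (intro det_diff_le norm_J_composition_diff_le norm_J_le)
  also have "\<dots> < \<bar>det (J k i x)\<bar>"
    using abs_det_J_greater[OF _ _ _ _ \<Gamma>_gap] i k by blast
  finally have "sgn (det (J k j p ** J j i x)) = sgn (det (J k i x))"
    by (rule sgn_eq_of_abs_diff_less)
  then show ?thesis
    using 1 by (simp add: transition_sign_def det_mul sgn_mult)
qed

section \<open>Local constancy of the signs\<close>

lemma transition_sign_eq_near:
  assumes j: "j \<in> I" "x \<in> U j" and k: "k \<in> I" "x \<in> U k"
  obtains r where "0 < r"
    "\<And>y. y \<in> U j \<Longrightarrow> y \<in> U k \<Longrightarrow> dist x y < r \<Longrightarrow> transition_sign A k j y = transition_sign A k j x"
proof -
  define C where "C = L\<^sub>E * (L\<^sub>E * L\<^sub>D' + L\<^sub>E' * L\<^sub>D ^ 2)"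
  \<comment> \<open>The determinant bound as a function of the distance. It is continuous with
    \<open>F 0 = 0\<close>, so it drops below the positive determinant at \<open>x\<close>.\<close>
  define F where "F t = real CARD('d) * (C * t) * (L\<^sub>E * L\<^sub>D + C * t) ^ (CARD('d) - 1)" for t
  have "0 < \<bar>det (J k j x)\<bar>"
    using gap_pos j k by (intro abs_det_J_greater) (simp_all flip: zero_ereal_def)
  moreover have "isCont F 0" unfolding F_def by (intro continuous_intros)
  ultimately obtain s where s: "0 < s" "\<And>t. dist t 0 < s \<Longrightarrow> dist (F t) (F 0) < \<bar>det (J k j x)\<bar>"
    unfolding continuous_at_eps_delta by meson
  have "x \<in> enc_dom (A j)" "open (enc_dom (A j))"
    using near_in_enc_dom[OF j] constants_nonneg atlas j by (auto simp: approx_ae_atlas_def)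
  then obtain r where r: "0 < r" "ball x r \<subseteq> enc_dom (A j)"
    using open_contains_ball by blast
  show ?thesis
  proof (rule that[of "min s r"])
    fix y assume y: "y \<in> U j" "y \<in> U k" "dist x y < min s r"
    \<comment> \<open>Centring the estimates at \<open>y\<close> shows that its reconstruction lies
      in the encoder domain of chart \<open>k\<close>.\<close>
    interpret y: bounded_ae_atlas_point M I A \<epsilon> \<eta> L\<^sub>E L\<^sub>E' L\<^sub>D L\<^sub>D' y
      using y j(1) atlas by unfold_locales (auto simp: approx_ae_atlas_def)
    have "\<bar>det (J k j y) - det (J k j x)\<bar> \<le> F (norm (y - x))"
      unfolding F_def
      using r y j k constants_nonneg \<Phi>_near_in_enc_dom[OF j k, of x] y.\<Phi>_near_in_enc_dom[of j k y]
      by (intro abs_det_J_diff_le[of j k "ball x r"]) (auto simp: C_def)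
    also have "\<dots> < \<bar>det (J k j x)\<bar>"
      using s(2)[of "norm (y - x)"] y by (simp add: F_def dist_norm norm_minus_commute)
    finally show "transition_sign A k j y = transition_sign A k j x"
      unfolding transition_sign_def by (rule sgn_eq_of_abs_diff_less)
  qed (use s r in auto)
qed

end

lemma (in bounded_ae_atlas) transition_sign_locally_constant:
  assumes "j \<in> I" "k \<in> I"
  shows "locally_constant_on (U j \<inter> U k) (transition_sign A k j)"
  unfolding locally_constant_on_def
proof
  fix x assume x: "x \<in> U j \<inter> U k"
  interpret bounded_ae_atlas_point M I A \<epsilon> \<eta> L\<^sub>E L\<^sub>E' L\<^sub>D L\<^sub>D' x
    using x assms(1) atlas by unfold_locales (auto simp: approx_ae_atlas_def)
  obtain r where r: "0 < r"
    "\<And>y. y \<in> U j \<Longrightarrow> y \<in> U k \<Longrightarrow> dist x y < r \<Longrightarrow> transition_sign A k j y = transition_sign A k j x"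
    using transition_sign_eq_near assms x by blast
  have "openin (top_of_set (U j \<inter> U k)) (U j \<inter> U k \<inter> ball x r)"
    by (intro openin_open_Int open_ball)
  moreover have "transition_sign A k j constant_on (U j \<inter> U k \<inter> ball x r)"
    using r(2) unfolding constant_on_def by auto
  ultimately show "\<exists>T. openin (top_of_set (U j \<inter> U k)) T \<and> x \<in> T \<and> transition_sign A k j constant_on T"
    using x r(1) by (metis Int_iff centre_in_ball)
qed

lemma (in bounded_ae_atlas) transition_sign_cases:
  assumes "j \<in> I" "k \<in> I" "x \<in> U j" "x \<in> U k"
  shows "transition_sign A k j x = 1 \<or> transition_sign A k j x = -1"
proof -
  have "0 < \<bar>det (J k j x)\<bar>"
    using assms gap_pos by (intro abs_det_J_greater) (simp_all flip: zero_ereal_def)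
  then show ?thesis by (auto simp: transition_sign_def sgn_real_def)
qed

section \<open>The Cech class of the transition signs\<close>

theorem theorem4p7:
  fixes M :: "(real ^ 'n::finite) set"
    and I :: "'i::linorder set"
    and A :: "'i \<Rightarrow> ('n, 'd::finite) ae_chart"
    and \<epsilon> \<eta> L\<^sub>E L\<^sub>E' L\<^sub>D L\<^sub>D' L\<^sub>\<Phi>' \<eta>\<^sub>e\<^sub>f\<^sub>f \<epsilon>t \<Gamma> C\<^sub>g K\<^sub>d\<^sub>e\<^sub>t :: real
  assumes "smooth_submanifold CARD('d) M" and "compact M"
    and "approx_ae_atlas M I A \<epsilon> \<eta>"
    and "0 < nondegeneracy_gap I A"
    and "\<And>k p. k \<in> I \<Longrightarrow> p \<in> enc_dom (A k) \<Longrightarrow>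
           onorm (frechet_derivative (enc (A k)) (at p)) \<le> L\<^sub>E"
    and "\<And>k p q. k \<in> I \<Longrightarrow> p \<in> enc_dom (A k) \<Longrightarrow> q \<in> enc_dom (A k) \<Longrightarrow>
           onorm (\<lambda>v. frechet_derivative (enc (A k)) (at p) v - frechet_derivative (enc (A k)) (at q) v)
             \<le> L\<^sub>E' * norm (p - q)"
    and "\<And>i z. i \<in> I \<Longrightarrow> z \<in> enc (A i) ` enc_dom (A i) \<Longrightarrow>
           onorm (frechet_derivative (dec (A i)) (at z)) \<le> L\<^sub>D"
    and "\<And>i z z'. i \<in> I \<Longrightarrow> z \<in> enc (A i) ` enc_dom (A i) \<Longrightarrow> z' \<in> enc (A i) ` enc_dom (A i) \<Longrightarrow>
           onorm (\<lambda>v. frechet_derivative (dec (A i)) (at z) v - frechet_derivative (dec (A i)) (at z') v)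
             \<le> L\<^sub>D' * norm (z - z')"
    and "ereal \<epsilon> < reach M"
    and "enlarged_nbhds I A \<epsilon> (L\<^sub>E * L\<^sub>D + 3)"
    and "L\<^sub>\<Phi>' = L\<^sub>D' * L\<^sub>E ^ 2 + L\<^sub>D * L\<^sub>E'"
    and "\<eta>\<^sub>e\<^sub>f\<^sub>f = (L\<^sub>E * L\<^sub>D + 2) * \<eta> / (1 - \<eta>) + L\<^sub>\<Phi>' * \<epsilon>"
    and "\<epsilon>t = (L\<^sub>E * L\<^sub>D + 2) * \<epsilon>"
    and "\<Gamma> = L\<^sub>E * \<eta>\<^sub>e\<^sub>f\<^sub>f * L\<^sub>D + L\<^sub>E' * \<epsilon>t * (1 + \<eta>\<^sub>e\<^sub>f\<^sub>f) * L\<^sub>D"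
    and "C\<^sub>g = L\<^sub>E * (L\<^sub>E * L\<^sub>D' + L\<^sub>E' * L\<^sub>D ^ 2)"
    and "K\<^sub>d\<^sub>e\<^sub>t = real CARD('d) * C\<^sub>g * \<epsilon> * (L\<^sub>E * L\<^sub>D + C\<^sub>g * \<epsilon>) ^ (CARD('d) - 1)"
    and "\<eta> < 1"
    and "ereal (max (real CARD('d) * \<Gamma> * (L\<^sub>E * L\<^sub>D + \<Gamma>) ^ (CARD('d) - 1)) K\<^sub>d\<^sub>e\<^sub>t)
           < nondegeneracy_gap I A"
  shows "(\<forall>i\<in>I. \<forall>j\<in>I. \<forall>k\<in>I. \<forall>x \<in> chart_dom (A i) \<inter> chart_dom (A j) \<inter> chart_dom (A k).
            transition_sign A k i x = transition_sign A k j x * transition_sign A j i x)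
       \<and> transition_sign_cochain I A \<in> cech_1_cocycles I (\<lambda>i. chart_dom (A i))
       \<and> cech_class I (\<lambda>i. chart_dom (A i)) (transition_sign_cochain I A)
           \<in> carrier (cech_H1 I (\<lambda>i. chart_dom (A i)))"
proof -
  interpret bounded_ae_atlas M I A \<epsilon> \<eta> L\<^sub>E L\<^sub>E' L\<^sub>D L\<^sub>D'
    by unfold_locales (fact assms)+
  let ?c = "transition_sign_cochain I A"
  have gap: "ereal (real CARD('d) * \<Gamma> * (L\<^sub>E * L\<^sub>D + \<Gamma>) ^ (CARD('d) - 1)) < nondegeneracy_gap I A"
    "ereal K\<^sub>d\<^sub>e\<^sub>t < nondegeneracy_gap I A"
    using assms(18) by (auto elim!: order.strict_trans1[rotated])
  have mult: "transition_sign A k i x = transition_sign A k j x * transition_sign A j i x"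
    if "i \<in> I" "j \<in> I" "k \<in> I" "x \<in> U i" "x \<in> U j" "x \<in> U k" for i j k x
  proof -
    interpret bounded_ae_atlas_point M I A \<epsilon> \<eta> L\<^sub>E L\<^sub>E' L\<^sub>D L\<^sub>D' x
      using that atlas by unfold_locales (auto simp: approx_ae_atlas_def)
    show ?thesis
      using assms(11-15) gap that unfolding assms(16)
      by (intro transition_sign_mult[where \<Gamma> = \<Gamma> and \<eta>e = \<eta>\<^sub>e\<^sub>f\<^sub>f and C = C\<^sub>g]) (auto simp: mult.assoc)
  qed
  have c: "?c (\<alpha>, \<beta>) x = transition_sign A \<beta> \<alpha> x"
    if "(\<alpha>, \<beta>) \<in> cech_pairs I U" "x \<in> U \<alpha>" "x \<in> U \<beta>" for \<alpha> \<beta> x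
    using that by (simp add: transition_sign_cochain_def)
  have "?c \<in> cech_1_cochains I U"
    unfolding cech_1_cochains_iff
  proof (intro conjI allI impI ballI)
    show "?c \<in> extensional (cech_pairs I U)"
      by (simp add: transition_sign_cochain_def)
    fix \<alpha> \<beta> assume ab: "(\<alpha>, \<beta>) \<in> cech_pairs I U"
    then have I: "\<alpha> \<in> I" "\<beta> \<in> I" by (auto simp: cech_pairs_def)
    show "?c (\<alpha>, \<beta>) \<in> extensional (U \<alpha> \<inter> U \<beta>)"
      using ab by (simp add: transition_sign_cochain_def)
    \<comment> \<open>The cochain agrees with the sign function only on the overlap; multiplication
      by the constant 1 serves as a congruence rule.\<close>
    show "locally_constant_on (U \<alpha> \<inter> U \<beta>) (?c (\<alpha>, \<beta>))"
      using c[OF ab]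
      by (intro locally_constant_on_mult[OF transition_sign_locally_constant[OF I]
            locally_constant_on_const[of _ "\<lambda>_. 1" 1]]) auto
    fix x assume "x \<in> U \<alpha> \<inter> U \<beta>"
    then show "?c (\<alpha>, \<beta>) x = 1 \<or> ?c (\<alpha>, \<beta>) x = -1"
      using transition_sign_cases[OF I] c[OF ab] by auto
  qed
  moreover have "?c (\<alpha>, \<gamma>) x = ?c (\<alpha>, \<beta>) x * ?c (\<beta>, \<gamma>) x"
    if "\<alpha> \<in> I" "\<beta> \<in> I" "\<gamma> \<in> I" "\<alpha> < \<beta>" "\<beta> < \<gamma>" "x \<in> U \<alpha> \<inter> U \<beta> \<inter> U \<gamma>" for \<alpha> \<beta> \<gamma> x
  proof -
    have "\<alpha> < \<gamma>" using that by simp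
    then have "(\<alpha>, \<gamma>) \<in> cech_pairs I U" "(\<alpha>, \<beta>) \<in> cech_pairs I U" "(\<beta>, \<gamma>) \<in> cech_pairs I U"
      using that by (auto simp: cech_pairs_def)
    \<comment> \<open>As the cochain at \<open>(\<alpha>, \<beta>)\<close> is the sign from \<alpha>
      to \<beta>, \<open>mult\<close> yields the two factors in the opposite order.\<close>
    then show ?thesis
      using that mult[of \<alpha> \<beta> \<gamma> x] by (simp add: c)
  qed
  ultimately have cocycle: "?c \<in> cech_1_cocycles I U"
    unfolding cech_1_cocycles_def by blast
  then have "cech_class I U ?c \<in> carrier (cech_H1 I U)"
    by (auto simp: cech_class_def cech_H1_def FactGroup_def RCOSETS_def carrier_cech_Z1)
  then show ?thesis using mult cocycle by blast
qed

end
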